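(* For each $n$ let $\bar\gamma_n$ be a lazy walk on $\{0,\dots,n\}$ with $\bar\gamma_n(0)=0$ minimizing $A(B,F;\gamma)$ among all lazy walks of length $n$ started at $0$ (free endpoint), and set \[ \ell_n=\operatorname{argmin}_{x\in\operatorname{range}(\bar\gamma_n)}d(x),\quad d_n=d(\ell_n),\quad \tau_n=\min\{i:\bar\gamma_n(i)\in\{\ell_n,\ell_n+1\}\}. \] Then with probability tending to $1$ as $n\to\infty$, $\bar\gamma_n(i)\in\{\ell_n,\ell_n+1\}$ for all $i\ge\tau_n$. Moreover, for every $\varepsilon>0$ there are $0<k_1<k_2$ such that for all sufficiently large $n$, \[ \mathbb P(k_1n^{\zeta}\le|\ell_n|\le k_2n^{\zeta})\ge1-\varepsilon,\quad \mathbb P(k_1n^{\zeta-1}\le d_n\le k_2n^{\zeta-1})\ge1-\varepsilon, \] \[ \mathbb P\big(k_1n^{\zeta}\le cn+A(B,F;\bar\gamma_n)\le k_2n^{\zeta}\big)\ge1-\varepsilon. \]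
   Context: Let $c>0$, $q>0$, $\kappa>-1$. $F=(F(x))_{x\in\mathbb Z}$ and $B=(B(i))_{i\in\mathbb Z}$ are mutually independent families of i.i.d. random variables, $\mathbb P(B(i)=\pm1)=1/2$, and $F(x)$ has a density $\varrho$ that is even, continuous, strictly positive on $(-c,c)$, zero outside $(-c,c)$, with $\lim_{x\to c}\varrho(x)/|c-x|^{\kappa}=q$. A lazy walk of length $n$ is $\gamma:\{0,\dots,n\}\to\mathbb Z$ with $|\gamma(i+1)-\gamma(i)|\le1$; its action is $A(B,F;\gamma)=\sum_{i=1}^nB(i)F(\gamma(i))$. The discrepancy of the edge $\{x,x+1\}$ is $d(x)=2c-|F(x+1)-F(x)|$. Let $\zeta=\frac{2\kappa+2}{2\kappa+3}$. *)

theory Defs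
  imports "HOL-Probability.Probability"
begin

text \<open>A lazy walk of length n: a map on {0..n} (values beyond n are irrelevant)
  with steps of size at most 1.\<close>
definition lazy_walk :: "nat \<Rightarrow> (nat \<Rightarrow> int) \<Rightarrow> bool" where
  "lazy_walk n \<gamma> \<longleftrightarrow> (\<forall>i<n. \<bar>\<gamma> (Suc i) - \<gamma> i\<bar> \<le> 1)"

definition action :: "(int \<Rightarrow> real) \<Rightarrow> (int \<Rightarrow> real) \<Rightarrow> nat \<Rightarrow> (nat \<Rightarrow> int) \<Rightarrow> real" where
  "action B F n \<gamma> = (\<Sum>i=1..n. B (int i) * F (\<gamma> i))"

definition optimal_walk :: "(int \<Rightarrow> real) \<Rightarrow> (int \<Rightarrow> real) \<Rightarrow> nat \<Rightarrow> (nat \<Rightarrow> int) \<Rightarrow> bool" where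
  "optimal_walk B F n \<gamma> \<longleftrightarrow> lazy_walk n \<gamma> \<and> \<gamma> 0 = 0 \<and>
     (\<forall>\<gamma>'. lazy_walk n \<gamma>' \<and> \<gamma>' 0 = 0 \<longrightarrow> action B F n \<gamma> \<le> action B F n \<gamma>')"

definition discrepancy :: "real \<Rightarrow> (int \<Rightarrow> real) \<Rightarrow> int \<Rightarrow> real" where
  "discrepancy c F x = 2 * c - \<bar>F (x + 1) - F x\<bar>"

definition hit_time :: "(nat \<Rightarrow> int) \<Rightarrow> int \<Rightarrow> nat" where
  "hit_time \<gamma> l = (LEAST i. \<gamma> i \<in> {l, l + 1})"

text \<open>Inner (lower) probability of an arbitrary, possibly non-measurable, set;
  coincides with the probability on events.\<close>
definition lprob :: "'a measure \<Rightarrow> 'a set \<Rightarrow> real" where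
  "lprob M A = (SUP E \<in> {E \<in> sets M. E \<subseteq> A}. measure M E)"

end

theory Submission
  imports Defs "HOL-Real_Asymp.Real_Asymp"
begin

text \<open>
  Write \<open>d\<close> for the discrepancy. Alternating on the edge \<open>{x, x + 1}\<close> costs
  \<open>d x / 2 + B i * (F x + F (x + 1)) / 2\<close> above the ideal value \<open>- c\<close> in step \<open>i\<close>, and
  \<open>\<bar>F x + F (x + 1)\<bar> \<le> d x\<close>. The smallest discrepancy among \<open>n powr \<zeta>\<close> edges is of order
  \<open>\<delta> = n powr (\<zeta> - 1)\<close>, so walking to the best one gives a total cost of order \<open>\<delta> * n = n powr \<zeta>\<close>.
  Conversely, a positive fraction of the sites stays away from \<open>\<plusminus>c\<close> and every visit there has
  a cost bounded below, so the range has order at most \<open>n powr \<zeta>\<close>.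

  For the sharp lower bound on the cost, call a site high if its gap \<open>c - \<bar>F x\<bar>\<close> is below a
  threshold slightly larger than \<open>\<delta>\<close>, and low otherwise. With high probability no three consecutive
  sites are high, so between two visits to low sites the walk is confined to a single edge. Cutting
  the walk at the low sites shows that \<open>m\<close> steps along edges of discrepancy at least \<open>D\<close> cost about
  \<open>D * m / 2\<close>: the fluctuations of the partial sums of \<open>B\<close> are absorbed by the cost of the cuts.

  With high probability every other edge in range has discrepancy at least \<open>d l + \<eta> * \<delta>\<close>, where
  \<open>l\<close> is the minimizer. An excursion away from \<open>{l, l + 1}\<close> starts at a low site and would
  therefore be strictly more expensive than alternating on \<open>{l, l + 1}\<close> during the same time.
\<close>

section \<open>Powers of real numbers\<close>

lemma has_integral_powr_interval:
  fixes a v w :: real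
  assumes "0 < a" "0 \<le> v" "v \<le> w"
  shows "((\<lambda>s. a * s powr (a - 1)) has_integral (w powr a - v powr a)) {v..w}"
proof (rule fundamental_theorem_of_calculus_interior)
  show "continuous_on {v..w} (\<lambda>s. s powr a)"
    using assms by (intro continuous_on_powr' continuous_intros) auto
  show "((\<lambda>s. s powr a) has_vector_derivative a * s powr (a - 1)) (at s)" if "s \<in> {v<..<w}" for s
    using that assms by (auto intro!: derivative_eq_intros
        simp: has_real_derivative_iff_has_vector_derivative[symmetric])
qed fact

lemma nn_integral_powr_interval:
  fixes a k v w :: real
  assumes "0 < a" "0 \<le> k" "0 \<le> v" "v \<le> w"
  shows "(\<integral>\<^sup>+s. ennreal (k * (a * s powr (a - 1))) * indicator {v..w} s \<partial>lborel) =
    ennreal (k * (w powr a - v powr a))"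
  using assms
  by (intro nn_integral_has_integral_lebesgue' has_integral_mult_right has_integral_powr_interval)
    auto

lemma powr_diff_le:
  fixes a :: real
  assumes "0 < a" "0 \<le> v" "v \<le> w" "w \<le> U"
  shows "w powr a - v powr a \<le> max 1 a * U powr (a - min 1 a) * (w - v) powr (min 1 a)"
proof (cases "v = w")
  case True
  then show ?thesis by simp
next
  case False
  then have vw: "v < w" using assms by simp
  show ?thesis
  proof (cases "a \<le> 1")
    case True
    have part_le: "x / w \<le> (x / w) powr a" if "0 \<le> x" "x \<le> w" for x
      using that vw assms True powr_mono'[of a 1 "x / w"] by (cases "x = 0") auto
    have "1 = (w - v) / w + v / w" using vw assms by (simp add: field_simps)
    also have "\<dots> \<le> ((w - v) / w) powr a + (v / w) powr a"
      using vw assms by (intro add_mono part_le) auto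
    finally have "w powr a * 1 \<le> w powr a * (((w - v) / w) powr a + (v / w) powr a)"
      by (rule mult_left_mono) simp
    then have "w powr a \<le> (w - v) powr a + v powr a"
      using vw assms by (simp add: powr_divide distrib_left)
    then show ?thesis using True vw assms by (simp add: max_def min_def)
  next
    case False
    have "continuous_on {v..w} (\<lambda>s. s powr a)"
      using assms by (intro continuous_on_powr' continuous_intros) auto
    moreover have "((\<lambda>s. s powr a) has_real_derivative a * s powr (a - 1)) (at s)" if "v < s" for s
      using that assms by (auto intro!: derivative_eq_intros)
    ultimately obtain z where z: "v < z" "z < w"
      "w powr a - v powr a = (w - v) * (a * z powr (a - 1))"
      using MVT[OF vw, of "\<lambda>s. s powr a"] real_differentiable_def DERIV_unique by metis
    have "z powr (a - 1) \<le> U powr (a - 1)" using z assms False by (intro powr_mono2) auto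
    then have "(w - v) * (a * z powr (a - 1)) \<le> (w - v) * (a * U powr (a - 1))"
      using vw assms by (intro mult_left_mono) auto
    then show ?thesis using z(3) False vw by (simp add: max_def min_def mult_ac)
  qed
qed

lemma tendsto_0_imp_ex_small:
  fixes f :: "real \<Rightarrow> real"
  assumes "(f \<longlongrightarrow> 0) (at_right 0)" "0 < e" "0 < b"
  shows "\<exists>x. 0 < x \<and> x \<le> b \<and> f x \<le> e"
proof -
  have "\<forall>\<^sub>F x in at_right 0. x \<in> {0<..<b} \<and> f x < e"
    using assms by (intro eventually_conj eventually_at_right_real order_tendstoD) auto
  then obtain x where "x \<in> {0<..<b} \<and> f x < e"
    using eventually_happens' trivial_limit_at_right_real by blast
  then show ?thesis by (intro exI[of _ x]) auto
qed

lemma powr_bounds_at_left: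
  fixes g :: "real \<Rightarrow> real"
  assumes "((\<lambda>t. g t / \<bar>c - t\<bar> powr \<kappa>) \<longlongrightarrow> q) (at_left c)" "lo < q" "q < hi"
  shows "\<exists>u>0. \<forall>s. 0 < s \<and> s \<le> u \<longrightarrow> lo * s powr \<kappa> \<le> g (c - s) \<and> g (c - s) \<le> hi * s powr \<kappa>"
proof -
  have "\<forall>\<^sub>F t in at_left c. lo < g t / \<bar>c - t\<bar> powr \<kappa> \<and> g t / \<bar>c - t\<bar> powr \<kappa> < hi"
    using assms by (intro eventually_conj order_tendstoD) auto
  then obtain t where t: "t < c" "\<And>y. t < y \<Longrightarrow> y < c \<Longrightarrow>
      lo < g y / \<bar>c - y\<bar> powr \<kappa> \<and> g y / \<bar>c - y\<bar> powr \<kappa> < hi"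
    using eventually_at_left[of "c - 1" c] by auto
  have "lo * s powr \<kappa> \<le> g (c - s) \<and> g (c - s) \<le> hi * s powr \<kappa>"
    if "0 < s" "s \<le> (c - t) / 2" for s
    using t(2)[of "c - s"] that t(1) by (auto simp: field_simps)
  then show ?thesis using t(1) by (intro exI[of _ "(c - t) / 2"]) auto
qed

section \<open>Probabilistic preliminaries\<close>

context prob_space
begin

lemma prob_disj_le:
  assumes "{\<omega>\<in>space M. P \<omega>} \<in> events" "{\<omega>\<in>space M. R \<omega>} \<in> events"
  shows "\<P>(\<omega> in M. P \<omega> \<or> R \<omega>) \<le> \<P>(\<omega> in M. P \<omega>) + \<P>(\<omega> in M. R \<omega>)"
proof -
  have "{\<omega>\<in>space M. P \<omega> \<or> R \<omega>} = {\<omega>\<in>space M. P \<omega>} \<union> {\<omega>\<in>space M. R \<omega>}" by auto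
  then show ?thesis using measure_Un_le[OF assms] by simp
qed

lemma prob_Bex_le:
  assumes "finite I" and "\<And>x. x \<in> I \<Longrightarrow> {\<omega>\<in>space M. P x \<omega>} \<in> events"
    and "\<And>x. x \<in> I \<Longrightarrow> \<P>(\<omega> in M. P x \<omega>) \<le> p"
  shows "\<P>(\<omega> in M. \<exists>x\<in>I. P x \<omega>) \<le> real (card I) * p"
proof -
  have "{\<omega>\<in>space M. \<exists>x\<in>I. P x \<omega>} = (\<Union>x\<in>I. {\<omega>\<in>space M. P x \<omega>})" by auto
  then have "\<P>(\<omega> in M. \<exists>x\<in>I. P x \<omega>) \<le> (\<Sum>x\<in>I. \<P>(\<omega> in M. P x \<omega>))"
    using measure_UNION_le[of I "\<lambda>x. {\<omega>\<in>space M. P x \<omega>}" M] assms by simp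
  also have "\<dots> \<le> (\<Sum>x\<in>I. p)" by (rule sum_mono) (rule assms)
  finally show ?thesis by simp
qed

lemma prob_card_ge_le:
  assumes "finite I" "0 < k" and P[measurable]: "\<And>x. {\<omega>\<in>space M. P x \<omega>} \<in> events"
    and p: "\<And>x. x \<in> I \<Longrightarrow> \<P>(\<omega> in M. P x \<omega>) \<le> p"
  shows "\<P>(\<omega> in M. k \<le> real (card {x\<in>I. P x \<omega>})) \<le> real (card I) * p / k"
proof -
  define Z :: "'a \<Rightarrow> real" where "Z \<omega> = (\<Sum>x\<in>I. indicator {\<omega>\<in>space M. P x \<omega>} \<omega>)" for \<omega>
  have int: "integrable M (indicator {\<omega>\<in>space M. P x \<omega>} :: 'a \<Rightarrow> real)" for x
    by (intro integrable_real_indicator P) (simp add: less_top[symmetric])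
  have "real (card {x\<in>I. P x \<omega>}) = Z \<omega>" if "\<omega> \<in> space M" for \<omega>
    using assms(1) that by (simp add: Z_def indicator_def sum.If_cases Int_def)
  then have "\<P>(\<omega> in M. k \<le> real (card {x\<in>I. P x \<omega>})) = \<P>(\<omega> in M. k \<le> Z \<omega>)"
    by (intro arg_cong[where f = prob]) auto
  also have "\<dots> \<le> expectation Z / k"
    using int assms(2) by (intro integral_Markov_inequality_measure[of _ _ "{}"])
      (auto simp: Z_def[abs_def] intro!: AE_I2 sum_nonneg)
  also have "expectation Z = (\<Sum>x\<in>I. \<P>(\<omega> in M. P x \<omega>))"
    unfolding Z_def[abs_def] using int by (subst Bochner_Integration.integral_sum) auto
  also have "\<dots> / k \<le> (\<Sum>x\<in>I. p) / k"
    using assms(2) p by (intro divide_right_mono sum_mono) auto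
  finally show ?thesis by simp
qed

lemma indep_vars_reindex:
  assumes "indep_vars N X I" "inj_on g J" "g ` J \<subseteq> I"
  shows "indep_vars (\<lambda>j. N (g j)) (\<lambda>j. X (g j)) J"
proof -
  have "indep_vars (\<lambda>j. N (g j)) (\<lambda>j \<omega>. (\<lambda>x. x (g j)) (restrict (\<lambda>i. X i \<omega>) {g j})) J"
    by (rule indep_vars_compose2[OF indep_vars_restrict[OF assms(1)]])
      (use assms(2,3) in \<open>auto simp: disjoint_family_on_def inj_on_def
        intro!: measurable_component_singleton\<close>)
  then show ?thesis by simp
qed

lemma indep_var_of_indep_vars:
  assumes "indep_vars (\<lambda>_. N) X I" "x \<in> I" "y \<in> I" "x \<noteq> y"
  shows "indep_var N (X x) N (X y)"
proof -
  have "indep_vars (\<lambda>_. N) (\<lambda>b. X (if b then x else y)) UNIV"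
    by (rule indep_vars_reindex[OF assms(1)])
      (use assms in \<open>auto simp: inj_on_def split: if_splits\<close>)
  moreover have "case_bool N N = (\<lambda>_. N)" "case_bool (X x) (X y) = (\<lambda>b. X (if b then x else y))"
    by (auto simp: fun_eq_iff split: bool.split)
  ultimately show ?thesis by (simp add: indep_var_def)
qed

lemma prob_indep_Ball_le_power:
  assumes ind: "indep_vars (\<lambda>_. N) X I" and J: "finite J" "J \<subseteq> I" and S: "S \<in> sets N"
    and p: "\<And>x. x \<in> J \<Longrightarrow> \<P>(\<omega> in M. X x \<omega> \<in> S) \<le> p"
  shows "\<P>(\<omega> in M. \<forall>x\<in>J. X x \<omega> \<in> S) \<le> p ^ card J"
proof (cases "J = {}")
  case True
  then show ?thesis by (simp add: prob_space)
next
  case False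
  have "{\<omega>\<in>space M. \<forall>x\<in>J. X x \<omega> \<in> S} = (\<Inter>x\<in>J. X x -` S \<inter> space M)"
    using False by auto
  then have "\<P>(\<omega> in M. \<forall>x\<in>J. X x \<omega> \<in> S) = (\<Prod>x\<in>J. prob (X x -` S \<inter> space M))"
    using indep_varsD[OF ind False J] S by simp
  also have "\<dots> \<le> (\<Prod>x\<in>J. p)"
    using p by (intro prod_mono) (auto simp: vimage_def Int_def conj_commute)
  finally show ?thesis by simp
qed

lemma prob_indep_section_le:
  assumes ind: "indep_var N X L Y" and A[measurable]: "A \<in> sets N"
    and R[measurable]: "Measurable.pred (N \<Otimes>\<^sub>M L) (\<lambda>(x, y). R x y)"
    and p: "\<And>x. x \<in> A \<Longrightarrow> \<P>(\<omega> in M. R x (Y \<omega>)) \<le> p" and "0 \<le> p"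
  shows "\<P>(\<omega> in M. X \<omega> \<in> A \<and> R (X \<omega>) (Y \<omega>)) \<le> \<P>(\<omega> in M. X \<omega> \<in> A) * p"
proof -
  note rv[measurable] = indep_var_rv1[OF ind] indep_var_rv2[OF ind]
  interpret DY: prob_space "distr M L Y" by (rule prob_space_distr) simp
  define W where "W = {z \<in> space (N \<Otimes>\<^sub>M L). fst z \<in> A \<and> (\<lambda>(x, y). R x y) z}"
  have W[measurable]: "W \<in> sets (N \<Otimes>\<^sub>M L)" unfolding W_def by measurable
  have section_le: "emeasure (distr M L Y) (Pair x -` W) \<le> ennreal p * indicator A x"
    if "x \<in> space N" for x
  proof (cases "x \<in> A")
    case True
    have "emeasure (distr M L Y) (Pair x -` W) = emeasure M (Y -` (Pair x -` W) \<inter> space M)"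
      by (rule emeasure_distr) (use W in \<open>auto intro: sets_Pair1\<close>)
    also have "Y -` (Pair x -` W) \<inter> space M = {\<omega>\<in>space M. R x (Y \<omega>)}"
      using True that measurable_space[OF rv(2)] by (auto simp: W_def space_pair_measure)
    finally show ?thesis using p[OF True] True by (simp add: emeasure_eq_measure ennreal_leI)
  next
    case False
    then show ?thesis by (simp add: W_def)
  qed
  have "{\<omega>\<in>space M. X \<omega> \<in> A \<and> R (X \<omega>) (Y \<omega>)} = (\<lambda>\<omega>. (X \<omega>, Y \<omega>)) -` W \<inter> space M"
    using measurable_space[OF rv(1)] measurable_space[OF rv(2)]
    by (auto simp: W_def space_pair_measure)
  then have "ennreal \<P>(\<omega> in M. X \<omega> \<in> A \<and> R (X \<omega>) (Y \<omega>)) =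
      emeasure (distr M N X \<Otimes>\<^sub>M distr M L Y) W"
    using ind by (simp add: indep_var_distribution_eq emeasure_distr emeasure_eq_measure)
  also have "\<dots> = (\<integral>\<^sup>+x. emeasure (distr M L Y) (Pair x -` W) \<partial>distr M N X)"
    by (rule DY.emeasure_pair_measure_alt) simp
  also have "\<dots> \<le> (\<integral>\<^sup>+x. ennreal p * indicator A x \<partial>distr M N X)"
    by (intro nn_integral_mono section_le) simp
  also have "\<dots> = ennreal p * emeasure (distr M N X) A"
    by (rule nn_integral_cmult_indicator) simp
  also have "\<dots> = ennreal (\<P>(\<omega> in M. X \<omega> \<in> A) * p)"
    using \<open>0 \<le> p\<close> by (simp add: emeasure_distr emeasure_eq_measure vimage_def Int_def conj_commute
        ennreal_mult' mult.commute)
  finally show ?thesis using \<open>0 \<le> p\<close> by (subst (asm) ennreal_le_iff) auto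
qed

lemma prob_interval_le_powr:
  assumes X: "distributed M lborel X (\<lambda>s. ennreal (g s))" and "0 < a" "0 \<le> k" "0 \<le> v" "v \<le> w"
    and g: "\<And>s. s \<in> {v..w} \<Longrightarrow> g s \<le> k * (a * s powr (a - 1))"
  shows "\<P>(\<omega> in M. X \<omega> \<in> {v..w}) \<le> k * (w powr a - v powr a)"
proof -
  have "ennreal \<P>(\<omega> in M. X \<omega> \<in> {v..w}) = (\<integral>\<^sup>+s. ennreal (g s) * indicator {v..w} s \<partial>lborel)"
    using distributed_emeasure[OF X, of "{v..w}"]
    by (simp add: emeasure_eq_measure vimage_def Int_def conj_commute)
  also have "\<dots> \<le> (\<integral>\<^sup>+s. ennreal (k * (a * s powr (a - 1))) * indicator {v..w} s \<partial>lborel)"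
    using g by (intro nn_integral_mono) (auto simp: indicator_def intro!: ennreal_leI)
  also have "\<dots> = ennreal (k * (w powr a - v powr a))"
    using assms(2-5) by (rule nn_integral_powr_interval)
  finally show ?thesis
    using assms(2-5) by (subst (asm) ennreal_le_iff) (auto intro!: mult_nonneg_nonneg powr_mono2)
qed

lemma prob_interval_ge_powr:
  assumes X: "distributed M lborel X (\<lambda>s. ennreal (g s))" and "0 < a" "0 \<le> k" "0 \<le> v" "v \<le> w"
    and g: "\<And>s. s \<in> {v..w} \<Longrightarrow> k * (a * s powr (a - 1)) \<le> g s"
  shows "k * (w powr a - v powr a) \<le> \<P>(\<omega> in M. X \<omega> \<in> {v..w})"
proof -
  have "ennreal (k * (w powr a - v powr a)) =
      (\<integral>\<^sup>+s. ennreal (k * (a * s powr (a - 1))) * indicator {v..w} s \<partial>lborel)"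
    using assms(2-5) by (rule nn_integral_powr_interval[symmetric])
  also have "\<dots> \<le> (\<integral>\<^sup>+s. ennreal (g s) * indicator {v..w} s \<partial>lborel)"
    using g by (intro nn_integral_mono) (auto simp: indicator_def intro!: ennreal_leI)
  also have "\<dots> = ennreal \<P>(\<omega> in M. X \<omega> \<in> {v..w})"
    using distributed_emeasure[OF X, of "{v..w}"]
    by (simp add: emeasure_eq_measure vimage_def Int_def conj_commute)
  finally show ?thesis by (subst (asm) ennreal_le_iff) auto
qed

lemma bdd_above_prob: "bdd_above (prob ` \<A>)"
  by (rule bdd_aboveI[of _ 1]) auto

lemma prob_le_lprob: "E \<in> events \<Longrightarrow> E \<subseteq> A \<Longrightarrow> prob E \<le> lprob M A"
  unfolding lprob_def by (rule cSUP_upper[OF _ bdd_above_prob]) simp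

lemma lprob_mono: "A \<subseteq> A' \<Longrightarrow> lprob M A \<le> lprob M A'"
  unfolding lprob_def by (rule cSUP_subset_mono[OF _ bdd_above_prob]) auto

lemma lprob_le_1: "lprob M A \<le> 1"
  unfolding lprob_def by (rule cSUP_least) auto

lemma lprob_tendsto_1:
  assumes "\<And>e. 0 < e \<Longrightarrow> \<forall>\<^sub>F n in sequentially. 1 - e \<le> lprob M (A n)"
  shows "(\<lambda>n. lprob M (A n)) \<longlonglongrightarrow> 1"
proof (rule tendstoI)
  fix e :: real assume "0 < e"
  then have "\<forall>\<^sub>F n in sequentially. 1 - e / 2 \<le> lprob M (A n)" by (intro assms) simp
  then show "\<forall>\<^sub>F n in sequentially. dist (lprob M (A n)) 1 < e"
  proof eventually_elim
    case (elim n)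
    then show ?case using lprob_le_1[of "A n"] \<open>0 < e\<close> by (simp add: dist_real_def)
  qed
qed

end

section \<open>Costs in a fixed environment\<close>

definition window :: "real \<Rightarrow> int set" where
  "window r = {- \<lfloor>r\<rfloor>..\<lfloor>r\<rfloor>}"

lemma mem_window_iff: "x \<in> window r \<longleftrightarrow> real_of_int \<bar>x\<bar> \<le> r"
  by (auto simp: window_def abs_le_iff le_floor_iff minus_le_iff)

lemma finite_window: "finite (window r)"
  by (simp add: window_def)

lemma card_window_le:
  assumes "1 \<le> r"
  shows "real (card (window r)) \<le> 3 * r"
proof -
  have "real (card (window r)) = 2 * of_int \<lfloor>r\<rfloor> + 1"
    using assms by (simp add: window_def)
  then show ?thesis using assms of_int_floor_le[of r] by linarith
qed

definition gap :: "real \<Rightarrow> (int \<Rightarrow> real) \<Rightarrow> int \<Rightarrow> real" where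
  "gap c f x = c - \<bar>f x\<bar>"

definition step_cost :: "real \<Rightarrow> (int \<Rightarrow> real) \<Rightarrow> (int \<Rightarrow> real) \<Rightarrow> (nat \<Rightarrow> int) \<Rightarrow> nat \<Rightarrow> real" where
  "step_cost c b f \<gamma> i = c + b (int i) * f (\<gamma> i)"

definition cheaper_end :: "(int \<Rightarrow> real) \<Rightarrow> (int \<Rightarrow> real) \<Rightarrow> int \<Rightarrow> nat \<Rightarrow> int" where
  "cheaper_end b f x i = (if b (int i) * f x \<le> b (int i) * f (x + 1) then x else x + 1)"

definition edge_cost :: "real \<Rightarrow> (int \<Rightarrow> real) \<Rightarrow> (int \<Rightarrow> real) \<Rightarrow> int \<Rightarrow> nat \<Rightarrow> real" where
  "edge_cost c b f x i = c + min (b (int i) * f x) (b (int i) * f (x + 1))"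

lemma sum_step_cost: "(\<Sum>i=1..n. step_cost c b f \<gamma> i) = c * real n + action b f n \<gamma>"
  by (simp add: step_cost_def action_def sum.distrib)

lemma step_cost_cheaper_end:
  "\<gamma> i = cheaper_end b f x i \<Longrightarrow> step_cost c b f \<gamma> i = edge_cost c b f x i"
  by (simp add: step_cost_def edge_cost_def cheaper_end_def)

lemma edge_cost_le_step_cost:
  "\<gamma> i \<in> {x, x + 1} \<Longrightarrow> edge_cost c b f x i \<le> step_cost c b f \<gamma> i"
  by (auto simp: step_cost_def edge_cost_def)

lemma optimal_walk_cost_le:
  assumes "optimal_walk b f n \<gamma>" "lazy_walk n \<gamma>'" "\<gamma>' 0 = 0"
  shows "(\<Sum>i=1..n. step_cost c b f \<gamma> i) \<le> (\<Sum>i=1..n. step_cost c b f \<gamma>' i)"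
  using assms unfolding sum_step_cost by (simp add: optimal_walk_def)

lemma sum_signed_bounds:
  fixes b :: "int \<Rightarrow> real" and s t :: nat
  assumes "\<bar>g\<bar> \<le> e"
  defines "S \<equiv> \<Sum>i=s..<t. b (int i)"
  shows "e * (real (t - s) - \<bar>S\<bar>) \<le> (\<Sum>i=s..<t. e + b (int i) * g)"
    and "(\<Sum>i=s..<t. e + b (int i) * g) \<le> e * (real (t - s) + \<bar>S\<bar>)"
proof -
  have "(\<Sum>i=s..<t. e + b (int i) * g) = e * real (t - s) + g * S"
    by (simp add: S_def sum.distrib sum_distrib_left mult.commute)
  moreover have "\<bar>g * S\<bar> \<le> e * \<bar>S\<bar>"
    using assms(1) by (simp add: abs_mult mult_right_mono)
  ultimately show "e * (real (t - s) - \<bar>S\<bar>) \<le> (\<Sum>i=s..<t. e + b (int i) * g)"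
    and "(\<Sum>i=s..<t. e + b (int i) * g) \<le> e * (real (t - s) + \<bar>S\<bar>)"
    by (simp_all add: abs_le_iff algebra_simps)
qed

lemma lazy_walk_visits:
  assumes lazy: "lazy_walk n \<gamma>" "\<gamma> 0 = 0" and t: "t \<le> n"
    and x: "0 < x \<and> x \<le> \<gamma> t \<or> \<gamma> t \<le> x \<and> x < 0"
  shows "\<exists>i\<in>{1..n}. \<gamma> i = x"
proof -
  have "\<exists>i\<le>t. \<gamma> i = x"
    using x
  proof
    assume "0 < x \<and> x \<le> \<gamma> t"
    then show ?thesis
      using lazy t by (intro nat0_intermed_int_val) (auto simp: lazy_walk_def)
  next
    assume "\<gamma> t \<le> x \<and> x < 0"
    then have "\<exists>i\<le>t. - \<gamma> i = - x"
      using lazy t by (intro nat0_intermed_int_val) (auto simp: lazy_walk_def abs_minus_commute)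
    then show ?thesis by simp
  qed
  then obtain i where "i \<le> t" "\<gamma> i = x" by blast
  moreover have "i \<noteq> 0" using x \<open>\<gamma> i = x\<close> lazy(2) by (cases "i = 0") auto
  ultimately show ?thesis using t by (intro bexI[of _ i]) auto
qed

lemma lazy_walk_stays:
  assumes lazy: "lazy_walk n \<gamma>" and t: "t \<le> Suc n" and "\<gamma> s \<in> S"
    and G: "\<And>i. i \<in> {s..<t} \<Longrightarrow> G (\<gamma> i)"
    and S: "\<And>y z. y \<in> S \<Longrightarrow> z \<in> {y - 1, y, y + 1} \<Longrightarrow> G z \<Longrightarrow> z \<in> S"
  shows "\<gamma> ` {s..<t} \<subseteq> S"
proof -
  have "\<gamma> i \<in> S" if "s \<le> i" "i < t" for i
    using that
  proof (induction i rule: dec_induct)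
    case base
    show ?case by fact
  next
    case (step i)
    have "\<bar>\<gamma> (Suc i) - \<gamma> i\<bar> \<le> 1"
      using lazy t step by (simp add: lazy_walk_def)
    then have "\<gamma> (Suc i) \<in> {\<gamma> i - 1, \<gamma> i, \<gamma> i + 1}" by auto
    then show ?case using S[of "\<gamma> i"] G[of "Suc i"] step by auto
  qed
  then show ?thesis by auto
qed

locale bounded_potential =
  fixes c :: real and b f :: "int \<Rightarrow> real"
  assumes f_bound: "\<And>x. \<bar>f x\<bar> \<le> c"
    and b_sign: "\<And>i. b i = 1 \<or> b i = -1"
begin

abbreviation "cost \<equiv> step_cost c b f"
abbreviation "disc \<equiv> discrepancy c f"

lemma gap_nonneg: "0 \<le> gap c f x"
  using f_bound[of x] by (simp add: gap_def)

lemma gap_le_cost: "gap c f (\<gamma> i) \<le> cost \<gamma> i"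
  using b_sign[of "int i"] by (auto simp: gap_def step_cost_def)

lemma cost_nonneg: "0 \<le> cost \<gamma> i"
  using gap_nonneg gap_le_cost by (rule order_trans)

lemma cost_le: "cost \<gamma> i \<le> 2 * c"
  using b_sign[of "int i"] f_bound[of "\<gamma> i"] by (auto simp: step_cost_def)

lemma abs_edge_sum_le_disc: "\<bar>f x + f (x + 1)\<bar> \<le> disc x"
  using f_bound[of x] f_bound[of "x + 1"] by (simp add: discrepancy_def)

lemma disc_nonneg: "0 \<le> disc x"
  using abs_edge_sum_le_disc[of x] by linarith

lemma gap_le_disc: "gap c f x \<le> disc x" "gap c f (x + 1) \<le> disc x"
  using f_bound[of x] f_bound[of "x + 1"] by (auto simp: gap_def discrepancy_def)

lemma edge_cost_eq:
  "edge_cost c b f x i = disc x / 2 + b (int i) * ((f x + f (x + 1)) / 2)"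
  using b_sign[of "int i"]
  by (auto simp: edge_cost_def discrepancy_def abs_if min_def field_simps)

lemma edge_cost_le_disc: "edge_cost c b f x i \<le> disc x"
  using abs_edge_sum_le_disc[of x] b_sign[of "int i"]
  by (auto simp: edge_cost_eq abs_le_iff field_simps)

lemma sum_edge_cost_bounds:
  fixes s t :: nat
  defines "S \<equiv> \<Sum>i=s..<t. b (int i)"
  shows "disc x / 2 * (real (t - s) - \<bar>S\<bar>) \<le> (\<Sum>i=s..<t. edge_cost c b f x i)"
    and "(\<Sum>i=s..<t. edge_cost c b f x i) \<le> disc x / 2 * (real (t - s) + \<bar>S\<bar>)"
  using sum_signed_bounds[where g = "(f x + f (x + 1)) / 2" and e = "disc x / 2" and b = b]
    abs_edge_sum_le_disc[of x]
  by (simp_all add: S_def edge_cost_eq)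

lemma abs_sum_signs_le: "\<bar>\<Sum>i=s..<t. b (int i)\<bar> \<le> real (t - s)"
proof -
  have "\<bar>b i\<bar> = 1" for i using b_sign[of i] by auto
  then show ?thesis using sum_abs[of "\<lambda>i. b (int i)" "{s..<t}"] by simp
qed

lemma edge_walk_cost_ge:
  assumes x: "\<gamma> ` {s..<t} \<subseteq> {x, x + 1}" and D: "D \<le> 2 * c"
    and edge: "{x, x + 1} \<subseteq> \<gamma> ` {s..<t} \<Longrightarrow> D \<le> disc x"
  shows "D / 2 * (real (t - s) - \<bar>\<Sum>i=s..<t. b (int i)\<bar>) \<le> (\<Sum>i=s..<t. cost \<gamma> i)"
proof -
  define m where "m = real (t - s) - \<bar>\<Sum>i=s..<t. b (int i)\<bar>"
  have m: "0 \<le> m" using abs_sum_signs_le[of s t] by (simp add: m_def)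
  have "D / 2 * m \<le> (\<Sum>i=s..<t. cost \<gamma> i)"
  proof (cases "{x, x + 1} \<subseteq> \<gamma> ` {s..<t}")
    case True
    have "D / 2 * m \<le> disc x / 2 * m" using edge[OF True] m by (intro mult_right_mono) auto
    also have "\<dots> \<le> (\<Sum>i=s..<t. edge_cost c b f x i)"
      unfolding m_def by (rule sum_edge_cost_bounds)
    also have "\<dots> \<le> (\<Sum>i=s..<t. cost \<gamma> i)"
      by (intro sum_mono edge_cost_le_step_cost) (use x in blast)
    finally show ?thesis .
  next
    case False
    then obtain y where y: "\<gamma> ` {s..<t} \<subseteq> {y}"
      using x by (metis empty_subsetI insert_commute insert_subset subset_insert)
    have "D / 2 * m \<le> c * m" using D m by (intro mult_right_mono) auto
    also have "\<dots> \<le> (\<Sum>i=s..<t. c + b (int i) * f y)"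
      unfolding m_def by (rule sum_signed_bounds) (rule f_bound)
    also have "\<dots> = (\<Sum>i=s..<t. cost \<gamma> i)"
      by (intro sum.cong refl) (use y in \<open>force simp: step_cost_def\<close>)
    finally show ?thesis .
  qed
  then show ?thesis by (simp add: m_def)
qed

lemma optimal_walk_cost_le_edge:
  assumes opt: "optimal_walk b f n \<gamma>" and x: "x \<le> n"
  shows "(\<Sum>i=1..n. cost \<gamma> i) \<le> 2 * c * real x + disc (int x) * real n"
proof -
  define \<gamma>' where "\<gamma>' i = (if i \<le> x then int i else cheaper_end b f (int x) i)" for i
  have "(\<Sum>i=1..n. cost \<gamma> i) \<le> (\<Sum>i=1..n. cost \<gamma>' i)"
    by (rule optimal_walk_cost_le[OF opt]) (auto simp: lazy_walk_def \<gamma>'_def cheaper_end_def)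
  also have "\<dots> = (\<Sum>i=1..x. cost \<gamma>' i) + (\<Sum>i=Suc x..n. cost \<gamma>' i)"
    using sum.ub_add_nat[of 1 x "cost \<gamma>'" "n - x"] x by simp
  also have "\<dots> \<le> (\<Sum>i=1..x. 2 * c) + (\<Sum>i=Suc x..n. disc (int x))"
  proof (intro add_mono sum_mono cost_le)
    fix i assume "i \<in> {Suc x..n}"
    then show "cost \<gamma>' i \<le> disc (int x)"
      using step_cost_cheaper_end[of \<gamma>' i b f "int x" c] edge_cost_le_disc[of "int x" i]
      by (simp add: \<gamma>'_def)
  qed
  also have "\<dots> \<le> 2 * c * real x + disc (int x) * real n"
    using disc_nonneg[of "int x"] by (simp add: mult.commute mult_right_mono)
  finally show ?thesis .
qed

lemma sum_gap_le_cost: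
  assumes visits: "\<And>x. x \<in> X \<Longrightarrow> \<exists>i\<in>{1..n}. \<gamma> i = x"
  shows "(\<Sum>x\<in>X. gap c f x) \<le> (\<Sum>i=1..n. cost \<gamma> i)"
proof -
  obtain T where T: "\<And>x. x \<in> X \<Longrightarrow> T x \<in> {1..n} \<and> \<gamma> (T x) = x"
    using visits by metis
  have "(\<Sum>x\<in>X. gap c f x) \<le> (\<Sum>x\<in>X. cost \<gamma> (T x))"
    by (rule sum_mono) (metis T gap_le_cost)
  also have "\<dots> = (\<Sum>i\<in>T ` X. cost \<gamma> i)"
    by (subst sum.reindex) (auto intro!: inj_onI dest: T simp: o_def, metis T)
  also have "\<dots> \<le> (\<Sum>i=1..n. cost \<gamma> i)"
    using T by (intro sum_mono2 cost_nonneg) auto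
  finally show ?thesis .
qed

end

section \<open>Walks among high sites\<close>

definition high_triple_free :: "real \<Rightarrow> (int \<Rightarrow> real) \<Rightarrow> real \<Rightarrow> real \<Rightarrow> bool" where
  "high_triple_free c f r h \<longleftrightarrow> (\<forall>x\<in>window r. \<exists>y\<in>{x - 1, x, x + 1}. h \<le> gap c f y)"

definition balanced_signs :: "(int \<Rightarrow> real) \<Rightarrow> nat \<Rightarrow> real \<Rightarrow> real \<Rightarrow> bool" where
  "balanced_signs b n \<epsilon> C \<longleftrightarrow>
    (\<forall>s\<in>{..Suc n}. \<forall>t\<in>{..Suc n}. s < t \<longrightarrow>
      \<bar>\<Sum>i=s..<t. b (int i)\<bar> < \<epsilon> * real (t - s) + C)"

definition excursion :: "nat \<Rightarrow> (nat \<Rightarrow> int) \<Rightarrow> int \<Rightarrow> nat \<Rightarrow> nat \<Rightarrow> bool" where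
  "excursion n \<gamma> l s t \<longleftrightarrow> s < t \<and> t \<le> n \<and> \<gamma> s \<in> {l, l + 1} \<and>
    (\<forall>i\<in>{Suc s..t}. \<gamma> i \<notin> {l, l + 1}) \<and> (t < n \<longrightarrow> \<gamma> (Suc t) \<in> {l, l + 1})"

lemma excursion_of_exit:
  assumes l: "l \<in> \<gamma> ` {0..n}" and i: "hit_time \<gamma> l \<le> i" "i \<le> n" "\<gamma> i \<notin> {l, l + 1}"
  obtains s t where "excursion n \<gamma> l s t"
proof
  have hit: "\<gamma> (hit_time \<gamma> l) \<in> {l, l + 1}"
    unfolding hit_time_def by (rule LeastI_ex) (use l in auto)
  define s where "s = (GREATEST j. j \<le> i \<and> \<gamma> j \<in> {l, l + 1})"
  have s: "s \<le> i \<and> \<gamma> s \<in> {l, l + 1}"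
    unfolding s_def by (rule GreatestI_nat[where b = i]) (use hit i in auto)
  have last: "j \<le> s" if "j \<le> i" "\<gamma> j \<in> {l, l + 1}" for j
    unfolding s_def by (rule Greatest_le_nat[where b = i]) (use that in auto)
  define t where "t = (LEAST j. i \<le> j \<and> (j = n \<or> \<gamma> (Suc j) \<in> {l, l + 1}))"
  have t: "i \<le> t \<and> (t = n \<or> \<gamma> (Suc t) \<in> {l, l + 1})"
    unfolding t_def by (rule LeastI[where k = n]) (use i in auto)
  have first: "t \<le> j" if "i \<le> j" "j = n \<or> \<gamma> (Suc j) \<in> {l, l + 1}" for j
    unfolding t_def by (rule Least_le) (use that in auto)
  have "\<gamma> j \<notin> {l, l + 1}" if j: "j \<in> {Suc s..t}" for j
  proof (cases "j \<le> i")
    case True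
    then show ?thesis using last[of j] j by auto
  next
    case False
    then have "i \<le> j - 1" "Suc (j - 1) = j" by auto
    then show ?thesis using first[of "j - 1"] j by auto
  qed
  moreover have "s < i" using s i by (metis le_neq_implies_less)
  ultimately show "excursion n \<gamma> l s t"
    using s t first[of n] i unfolding excursion_def by auto
qed

lemma excursion_edge_far:
  assumes ex: "excursion n \<gamma> l s t" and x: "{x, x + 1} \<subseteq> \<gamma> ` {Suc s..t}"
  shows "2 \<le> \<bar>x - l\<bar>"
proof -
  have "\<gamma> ` {Suc s..t} \<inter> {l, l + 1} = {}" using ex by (auto simp: excursion_def)
  then have "x \<noteq> l" "x \<noteq> l + 1" "x + 1 \<noteq> l" using x by blast+
  then show ?thesis by presburger
qed

lemma lazy_walk_override_excursion:
  assumes lazy: "lazy_walk n \<gamma>" and ex: "excursion n \<gamma> l s t"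
    and edge: "\<And>i. \<gamma>' i \<in> {l, l + 1}"
  shows "lazy_walk n (override_on \<gamma> \<gamma>' {Suc s..t})"
proof -
  define \<pi> where "\<pi> = override_on \<gamma> \<gamma>' {Suc s..t}"
  have on_edge: "\<pi> j \<in> {l, l + 1}" if "s \<le> j" "j \<le> Suc t" "j \<le> n" for j
  proof (cases "j \<in> {Suc s..t}")
    case True
    then show ?thesis using edge by (simp add: \<pi>_def)
  next
    case False
    then have "j = s \<or> j = Suc t" using that by auto
    then show ?thesis using ex that(3) by (auto simp: \<pi>_def excursion_def)
  qed
  have "\<bar>\<pi> (Suc j) - \<pi> j\<bar> \<le> 1" if "j < n" for j
  proof (cases "s \<le> j \<and> j \<le> t")
    case True
    then show ?thesis using on_edge[of j] on_edge[of "Suc j"] that by auto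
  next
    case False
    then show ?thesis using lazy that by (auto simp: \<pi>_def override_on_def lazy_walk_def)
  qed
  then show ?thesis by (simp add: lazy_walk_def \<pi>_def)
qed

lemma optimal_excursion_cost_le:
  assumes opt: "optimal_walk b f n \<gamma>" and ex: "excursion n \<gamma> l s t"
  shows "(\<Sum>i=Suc s..t. step_cost c b f \<gamma> i) \<le> (\<Sum>i=Suc s..t. edge_cost c b f l i)"
proof -
  define \<gamma>' where "\<gamma>' = override_on \<gamma> (cheaper_end b f l) {Suc s..t}"
  have "lazy_walk n \<gamma>'"
    unfolding \<gamma>'_def using opt
    by (intro lazy_walk_override_excursion[OF _ ex]) (auto simp: optimal_walk_def cheaper_end_def)
  then have "(\<Sum>i=1..n. step_cost c b f \<gamma> i) \<le> (\<Sum>i=1..n. step_cost c b f \<gamma>' i)"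
    using opt by (intro optimal_walk_cost_le[OF opt]) (auto simp: \<gamma>'_def optimal_walk_def)
  moreover have "(\<Sum>i=1..n. w i) = (\<Sum>i\<in>{1..n} - {Suc s..t}. w i) + (\<Sum>i=Suc s..t. w i)"
    for w :: "nat \<Rightarrow> real"
    using ex by (intro sum.subset_diff) (auto simp: excursion_def)
  moreover have "(\<Sum>i\<in>{1..n} - {Suc s..t}. step_cost c b f \<gamma>' i) =
      (\<Sum>i\<in>{1..n} - {Suc s..t}. step_cost c b f \<gamma> i)"
    by (rule sum.cong) (auto simp: \<gamma>'_def step_cost_def)
  moreover have "(\<Sum>i=Suc s..t. step_cost c b f \<gamma>' i) = (\<Sum>i=Suc s..t. edge_cost c b f l i)"
    by (intro sum.cong refl step_cost_cheaper_end) (auto simp: \<gamma>'_def)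
  ultimately show ?thesis by simp
qed

locale regular_environment = bounded_potential +
  fixes n :: nat and r h \<epsilon> C :: real
  assumes triple_free: "high_triple_free c f (r + 1) h"
    and balanced: "balanced_signs b n \<epsilon> C"
    and eps_nonneg: "0 \<le> \<epsilon>" and C_nonneg: "0 \<le> C"
begin

lemma ex_low_neighbour:
  assumes "real_of_int \<bar>x\<bar> \<le> r + 1"
  shows "\<exists>y\<in>{x - 1, x, x + 1}. h \<le> gap c f y"
  using triple_free assms by (simp add: high_triple_free_def mem_window_iff)

lemma abs_sum_signs_le_balanced:
  assumes "s \<le> t" "t \<le> Suc n"
  shows "\<bar>\<Sum>i=s..<t. b (int i)\<bar> \<le> \<epsilon> * real (t - s) + C"
proof (cases "s = t")
  case True
  then show ?thesis using C_nonneg by simp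
next
  case False
  then show ?thesis using balanced assms by (auto simp: balanced_signs_def intro: less_imp_le)
qed

lemma sum_edge_cost_le:
  assumes "s \<le> t" "t \<le> Suc n"
  shows "(\<Sum>i=s..<t. edge_cost c b f x i) \<le> disc x / 2 * ((1 + \<epsilon>) * real (t - s) + C)"
proof -
  have "(\<Sum>i=s..<t. edge_cost c b f x i) \<le> disc x / 2 * (real (t - s) + \<bar>\<Sum>i=s..<t. b (int i)\<bar>)"
    by (rule sum_edge_cost_bounds)
  also have "\<dots> \<le> disc x / 2 * ((1 + \<epsilon>) * real (t - s) + C)"
    using abs_sum_signs_le_balanced[OF assms] disc_nonneg[of x]
    by (intro mult_left_mono) (auto simp: algebra_simps)
  finally show ?thesis .
qed

lemma high_run_on_edge:
  assumes lazy: "lazy_walk n \<gamma>" and range: "\<gamma> ` {0..n} \<subseteq> window r" and t: "s < t" "t \<le> Suc n"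
    and high: "\<And>i. i \<in> {s..<t} \<Longrightarrow> gap c f (\<gamma> i) < h"
  shows "\<exists>x. \<gamma> ` {s..<t} \<subseteq> {x, x + 1}"
proof -
  let ?high = "\<lambda>x. gap c f x < h"
  define p where "p = \<gamma> s"
  have "p \<in> window r" using range t by (auto simp: p_def)
  then have p: "?high p" "real_of_int \<bar>p\<bar> \<le> r"
    using high[of s] t by (auto simp: p_def mem_window_iff)
  have shifted: "real_of_int \<bar>p + 1\<bar> \<le> r + 1" "real_of_int \<bar>p - 1\<bar> \<le> r + 1"
    using p(2) by linarith+
  have not_both: "\<not> (?high (p - 1) \<and> ?high (p + 1))"
    and not_two_right: "\<not> (?high (p + 1) \<and> ?high (p + 1 + 1))"
    and not_two_left: "\<not> (?high (p - 1) \<and> ?high (p - 1 - 1))"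
    using ex_low_neighbour[of p] ex_low_neighbour[OF shifted(1)] ex_low_neighbour[OF shifted(2)] p
    by auto
  consider (right) "?high (p + 1)" | (left) "?high (p - 1)"
    | (isolated) "\<not> ?high (p + 1)" "\<not> ?high (p - 1)" by blast
  then show ?thesis
  proof cases
    case right
    have "\<gamma> ` {s..<t} \<subseteq> {p, p + 1}"
    proof (rule lazy_walk_stays[OF lazy t(2)])
      show "z \<in> {p, p + 1}" if "y \<in> {p, p + 1}" "z \<in> {y - 1, y, y + 1}" "?high z" for y z
        using that right not_both not_two_right by auto
    qed (simp_all add: p_def high)
    then show ?thesis by blast
  next
    case left
    have "\<gamma> ` {s..<t} \<subseteq> {p - 1, p - 1 + 1}"
    proof (rule lazy_walk_stays[OF lazy t(2)])
      show "z \<in> {p - 1, p - 1 + 1}"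
        if "y \<in> {p - 1, p - 1 + 1}" "z \<in> {y - 1, y, y + 1}" "?high z" for y z
        using that left not_both not_two_left by auto
    qed (simp_all add: p_def high)
    then show ?thesis by blast
  next
    case isolated
    have "\<gamma> ` {s..<t} \<subseteq> {p}"
    proof (rule lazy_walk_stays[OF lazy t(2)])
      show "z \<in> {p}" if "y \<in> {p}" "z \<in> {y - 1, y, y + 1}" "?high z" for y z
        using that isolated by auto
    qed (simp_all add: p_def high)
    then show ?thesis by blast
  qed
qed

lemma high_run_cost_ge:
  assumes lazy: "lazy_walk n \<gamma>" and range: "\<gamma> ` {0..n} \<subseteq> window r"
    and t: "s \<le> t" "t \<le> Suc n" and D: "0 \<le> D" "D \<le> 2 * c"
    and edges: "\<And>x. {x, x + 1} \<subseteq> \<gamma> ` {s..<t} \<Longrightarrow> D \<le> disc x"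
    and high: "\<And>i. i \<in> {s..<t} \<Longrightarrow> gap c f (\<gamma> i) < h"
  shows "D / 2 * ((1 - \<epsilon>) * real (t - s) - C) \<le> (\<Sum>i=s..<t. cost \<gamma> i)"
proof (cases "s = t")
  case True
  then show ?thesis using D C_nonneg by simp
next
  case False
  then obtain x where x: "\<gamma> ` {s..<t} \<subseteq> {x, x + 1}"
    using high_run_on_edge[OF lazy range _ t(2) high] t by force
  have "D / 2 * ((1 - \<epsilon>) * real (t - s) - C) \<le> D / 2 * (real (t - s) - \<bar>\<Sum>i=s..<t. b (int i)\<bar>)"
    using abs_sum_signs_le_balanced[OF t] D by (intro mult_left_mono) (auto simp: algebra_simps)
  also have "\<dots> \<le> (\<Sum>i=s..<t. cost \<gamma> i)"
    by (rule edge_walk_cost_ge[OF x D(2) edges])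
  finally show ?thesis .
qed

text \<open>Cutting a walk at a low site loses at most \<open>D / 2 * (C + 1)\<close> in the bound on the cost
  of a walk along high sites, which the cost \<open>h\<close> of that site pays for.\<close>
lemma walk_cost_ge:
  assumes lazy: "lazy_walk n \<gamma>" and range: "\<gamma> ` {0..n} \<subseteq> window r"
    and t: "s \<le> t" "t \<le> Suc n" and D: "0 \<le> D" "D \<le> 2 * c"
    and edges: "\<And>x. {x, x + 1} \<subseteq> \<gamma> ` {s..<t} \<Longrightarrow> D \<le> disc x"
    and h: "D / 2 * (C + 1) \<le> h"
  shows "D / 2 * ((1 - \<epsilon>) * real (t - s) - C) \<le> (\<Sum>i=s..<t. cost \<gamma> i)"
  using t(1) edges
proof (induction "t - s" arbitrary: s rule: less_induct)
  case less
  show ?case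
  proof (cases "\<forall>i\<in>{s..<t}. gap c f (\<gamma> i) < h")
    case True
    then show ?thesis
      using less.prems D t(2) by (intro high_run_cost_ge[OF lazy range]) auto
  next
    case False
    then obtain u where u: "s \<le> u" "u < t" "h \<le> gap c f (\<gamma> u)"
      "\<And>i. i \<in> {s..<u} \<Longrightarrow> gap c f (\<gamma> i) < h"
      using exists_least_iff[of "\<lambda>i. i \<in> {s..<t} \<and> h \<le> gap c f (\<gamma> i)"]
      by (auto simp: not_less) (metis less_trans not_le order.trans)
    have mono: "\<gamma> ` {s..<u} \<subseteq> \<gamma> ` {s..<t}" "\<gamma> ` {Suc u..<t} \<subseteq> \<gamma> ` {s..<t}" using u by auto
    have "D / 2 * ((1 - \<epsilon>) * real (u - s) - C) \<le> (\<Sum>i=s..<u. cost \<gamma> i)"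
      using u t(2) D less.prems(2) mono by (intro high_run_cost_ge[OF lazy range]) auto
    moreover have "h \<le> cost \<gamma> u"
      using u(3) gap_le_cost by (rule order_trans)
    moreover have "D / 2 * ((1 - \<epsilon>) * real (t - Suc u) - C) \<le> (\<Sum>i=Suc u..<t. cost \<gamma> i)"
      using u less.prems(2) mono by (intro less.hyps) auto
    moreover have "(\<Sum>i=s..<t. cost \<gamma> i) =
        (\<Sum>i=s..<u. cost \<gamma> i) + (cost \<gamma> u + (\<Sum>i=Suc u..<t. cost \<gamma> i))"
      using u by (simp add: sum.atLeast_Suc_lessThan[symmetric] sum.atLeastLessThan_concat)
    moreover have "real (t - s) = real (u - s) + 1 + real (t - Suc u)" using u by simp
    then have "D / 2 * ((1 - \<epsilon>) * real (t - s) - C) = D / 2 * ((1 - \<epsilon>) * real (u - s) - C)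
        + D / 2 * ((1 - \<epsilon>) * real (t - Suc u) - C) + D / 2 * (C + 1) - D / 2 * \<epsilon>"
      by (simp add: algebra_simps add_divide_distrib diff_divide_distrib)
    moreover have "0 \<le> D / 2 * \<epsilon>" using D eps_nonneg by simp
    ultimately show ?thesis using h by linarith
  qed
qed

lemma excursion_starts_low:
  assumes lazy: "lazy_walk n \<gamma>" and l: "real_of_int \<bar>l\<bar> \<le> r" "disc l < h"
    and ex: "excursion n \<gamma> l s t"
  shows "h \<le> gap c f (\<gamma> (Suc s))"
proof -
  have "\<bar>\<gamma> (Suc s) - \<gamma> s\<bar> \<le> 1" "\<gamma> s \<in> {l, l + 1}" "\<gamma> (Suc s) \<notin> {l, l + 1}"
    using lazy ex by (auto simp: lazy_walk_def excursion_def)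
  then consider "\<gamma> (Suc s) = l - 1" | "\<gamma> (Suc s) = l + 2" by force
  moreover have "gap c f l < h" "gap c f (l + 1) < h"
    using gap_le_disc[of l] l(2) by auto
  ultimately show ?thesis
    using ex_low_neighbour[of l] ex_low_neighbour[of "l + 1"] l(1)
    by cases (auto simp: add.commute)
qed

lemma excursion_cost_gt:
  assumes lazy: "lazy_walk n \<gamma>" and range: "\<gamma> ` {0..n} \<subseteq> window r"
    and l: "real_of_int \<bar>l\<bar> \<le> r" "disc l < h" and ex: "excursion n \<gamma> l s t"
    and D: "0 \<le> D" "D \<le> 2 * c" "(1 + \<epsilon>) * disc l \<le> (1 - \<epsilon>) * D"
    and edges: "\<And>x. x \<in> \<gamma> ` {0..n} \<Longrightarrow> 2 \<le> \<bar>x - l\<bar> \<Longrightarrow> D \<le> disc x"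
    and h: "D / 2 * (C + 1) + disc l / 2 * C < h"
  shows "(\<Sum>i=Suc s..t. edge_cost c b f l i) < (\<Sum>i=Suc s..t. cost \<gamma> i)"
proof -
  have st: "s < t" "t \<le> n" using ex by (auto simp: excursion_def)
  have upper: "(\<Sum>i=Suc s..<Suc t. edge_cost c b f l i) \<le> disc l / 2 * ((1 + \<epsilon>) * real (t - s) + C)"
    using sum_edge_cost_le[of "Suc s" "Suc t"] st by simp
  have first: "h \<le> cost \<gamma> (Suc s)"
    using excursion_starts_low[OF lazy l ex] gap_le_cost by (rule order_trans)
  have rest: "D / 2 * ((1 - \<epsilon>) * real (t - Suc s) - C) \<le> (\<Sum>i=Suc (Suc s)..<Suc t. cost \<gamma> i)"
  proof -
    have "D \<le> disc x" if x: "{x, x + 1} \<subseteq> \<gamma> ` {Suc (Suc s)..<Suc t}" for x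
    proof (rule edges)
      show "x \<in> \<gamma> ` {0..n}" using x st by auto
      have "\<gamma> ` {Suc (Suc s)..<Suc t} \<subseteq> \<gamma> ` {Suc s..t}" by (rule image_mono) auto
      then show "2 \<le> \<bar>x - l\<bar>" by (intro excursion_edge_far[OF ex] order_trans[OF x])
    qed
    moreover have "0 \<le> disc l / 2 * C" using disc_nonneg[of l] C_nonneg by simp
    then have "D / 2 * (C + 1) \<le> h" using h by linarith
    ultimately show ?thesis
      using walk_cost_ge[OF lazy range, of "Suc (Suc s)" "Suc t" D] st D(1,2) by simp
  qed
  have "(1 + \<epsilon>) * disc l / 2 * real (t - s) \<le> (1 - \<epsilon>) * D / 2 * real (t - s)"
    using D(3) by (intro mult_right_mono) auto
  moreover have "(1 - \<epsilon>) * D / 2 * real (t - s) =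
      D / 2 * ((1 - \<epsilon>) * real (t - Suc s) - C) + D / 2 * (C + 1) - D / 2 * \<epsilon>"
    using st by (simp add: of_nat_diff algebra_simps add_divide_distrib diff_divide_distrib)
  moreover have "0 \<le> D / 2 * \<epsilon>" using D(1) eps_nonneg by simp
  moreover have "disc l / 2 * ((1 + \<epsilon>) * real (t - s) + C) =
      (1 + \<epsilon>) * disc l / 2 * real (t - s) + disc l / 2 * C"
    by (simp add: algebra_simps add_divide_distrib)
  moreover have "(\<Sum>i=Suc s..<Suc t. cost \<gamma> i) = cost \<gamma> (Suc s) + (\<Sum>i=Suc (Suc s)..<Suc t. cost \<gamma> i)"
    using st by (intro sum.atLeast_Suc_lessThan) auto
  ultimately show ?thesis
    using upper first rest h unfolding atLeastLessThanSuc_atLeastAtMost by linarith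
qed

end

section \<open>Optimal walks in a good environment\<close>

definition cheap_edge_within :: "real \<Rightarrow> (int \<Rightarrow> real) \<Rightarrow> real \<Rightarrow> real \<Rightarrow> bool" where
  "cheap_edge_within c f r d \<longleftrightarrow> (\<exists>x\<in>{0..\<lfloor>r\<rfloor>}. discrepancy c f x \<le> d)"

definition discs_exceed :: "real \<Rightarrow> (int \<Rightarrow> real) \<Rightarrow> real \<Rightarrow> real \<Rightarrow> bool" where
  "discs_exceed c f r d \<longleftrightarrow> (\<forall>x\<in>window r. d < discrepancy c f x)"

definition small_discs_separated :: "real \<Rightarrow> (int \<Rightarrow> real) \<Rightarrow> real \<Rightarrow> real \<Rightarrow> real \<Rightarrow> bool" where
  "small_discs_separated c f r d w \<longleftrightarrow>
    (\<forall>x\<in>window r. \<forall>y\<in>window r. 2 \<le> \<bar>x - y\<bar> \<longrightarrow>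
      discrepancy c f x \<le> d \<longrightarrow> discrepancy c f y \<le> d \<longrightarrow>
      w < \<bar>discrepancy c f x - discrepancy c f y\<bar>)"

definition gap_sums_exceed :: "real \<Rightarrow> (int \<Rightarrow> real) \<Rightarrow> real \<Rightarrow> real \<Rightarrow> bool" where
  "gap_sums_exceed c f r a \<longleftrightarrow>
    a < (\<Sum>x\<in>{1..\<lfloor>r\<rfloor>}. gap c f x) \<and> a < (\<Sum>x\<in>{- \<lfloor>r\<rfloor>..-1}. gap c f x)"

text \<open>Here \<open>\<delta>\<close> is the scale of the smallest discrepancy, and the optimal cost is at most
  \<open>A * \<delta> * n\<close>; the factor 8 is what the lower bound \<open>D * n / 8\<close> for the cost of a walk along
  edges of discrepancy at least \<open>D\<close> gives away.\<close>
locale good_parameters =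
  fixes c :: real and n :: nat and h \<epsilon> C \<delta> A k \<eta> :: real
  assumes n_pos: "0 < n" and \<delta>_pos: "0 < \<delta>" and \<delta>_le_1: "\<delta> \<le> 1" and A_pos: "0 < A"
    and k: "0 \<le> k" "k \<le> 1" and \<eta>: "0 < \<eta>" "\<eta> \<le> 1"
    and \<epsilon>_le: "\<epsilon> \<le> 1 / 2" "32 * A * \<epsilon> \<le> \<eta>" and C_le: "C \<le> real n / 4"
    and \<delta>_less_h: "(8 * A + 1) * \<delta> * (C + 1) < h" and \<delta>_le_c: "(8 * A + 1) * \<delta> \<le> 2 * c"

locale good_environment =
  regular_environment c b f n r h \<epsilon> C + good_parameters c n h \<epsilon> C \<delta> A k \<eta>
  for c b f n r h \<epsilon> C \<delta> A k \<eta> +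
  assumes cheap_edge: "cheap_edge_within c f (\<delta> * n) ((A - 2 * c) * \<delta>)"
    and escape: "gap_sums_exceed c f r (A * \<delta> * n)"
    and disc_lower: "discs_exceed c f r (k * \<delta>)"
    and near_disc_lower: "discs_exceed c f (k * \<delta> * n) (8 * A * \<delta>)"
    and separated: "small_discs_separated c f r ((8 * A + 1) * \<delta>) (\<eta> * \<delta>)"

locale optimal_walk_in_good_environment = good_environment +
  fixes \<gamma> :: "nat \<Rightarrow> int" and l :: int
  assumes optimal: "optimal_walk b f n \<gamma>" and l_mem: "l \<in> \<gamma> ` {0..n}"
    and l_min: "\<And>x. x \<in> \<gamma> ` {0..n} \<Longrightarrow> disc l \<le> disc x"
begin

abbreviation "total_cost \<equiv> \<Sum>i=1..n. cost \<gamma> i"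

lemma lazy_walk_optimal: "lazy_walk n \<gamma>" and optimal_start: "\<gamma> 0 = 0"
  using optimal by (auto simp: optimal_walk_def)

lemma total_cost_le: "total_cost \<le> A * \<delta> * n"
proof -
  obtain y where y: "0 \<le> y" "y \<le> \<lfloor>\<delta> * n\<rfloor>" "disc y \<le> (A - 2 * c) * \<delta>"
    using cheap_edge by (auto simp: cheap_edge_within_def)
  obtain x where x: "y = int x" using y(1) by (rule nonneg_int_cases)
  have x_le: "real x \<le> \<delta> * n" using y(2) x by (simp add: le_floor_iff)
  also have "\<dots> \<le> 1 * real n" using \<delta>_le_1 by (intro mult_right_mono) auto
  finally have "x \<le> n" by simp
  then have "total_cost \<le> 2 * c * real x + disc (int x) * n"
    by (rule optimal_walk_cost_le_edge[OF optimal])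
  also have "\<dots> \<le> 2 * c * (\<delta> * n) + (A - 2 * c) * \<delta> * n"
    using x_le y(3) x f_bound[of 0] by (intro add_mono mult_left_mono mult_right_mono) auto
  finally show ?thesis by (simp add: algebra_simps)
qed

lemma range_subset_window: "\<gamma> ` {0..n} \<subseteq> window r"
proof (rule image_subsetI, rule ccontr)
  fix t assume "t \<in> {0..n}" "\<gamma> t \<notin> window r"
  then have t: "t \<le> n" "\<lfloor>r\<rfloor> < \<bar>\<gamma> t\<bar>" by (auto simp: mem_window_iff floor_less_iff)
  have visits: "\<exists>i\<in>{1..n}. \<gamma> i = x" if "0 < x \<and> x \<le> \<gamma> t \<or> \<gamma> t \<le> x \<and> x < 0" for x
    by (rule lazy_walk_visits[OF lazy_walk_optimal optimal_start t(1) that])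
  have "A * \<delta> * n < total_cost"
  proof (cases "0 \<le> \<gamma> t")
    case True
    have "(\<Sum>x\<in>{1..\<lfloor>r\<rfloor>}. gap c f x) \<le> total_cost"
      by (rule sum_gap_le_cost[OF visits]) (use t True in auto)
    then show ?thesis using escape by (simp add: gap_sums_exceed_def)
  next
    case False
    have "(\<Sum>x\<in>{- \<lfloor>r\<rfloor>..-1}. gap c f x) \<le> total_cost"
      by (rule sum_gap_le_cost[OF visits]) (use t False in auto)
    then show ?thesis using escape by (simp add: gap_sums_exceed_def)
  qed
  then show False using total_cost_le by simp
qed

lemma abs_l_le: "real_of_int \<bar>l\<bar> \<le> r"
  using l_mem range_subset_window by (auto simp: mem_window_iff)

lemma disc_range_gt: "x \<in> \<gamma> ` {0..n} \<Longrightarrow> k * \<delta> < disc x"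
  using disc_lower range_subset_window by (auto simp: discs_exceed_def)

lemma total_cost_ge:
  assumes D: "0 \<le> D" "D \<le> (8 * A + 1) * \<delta>" and edges: "\<And>x. x \<in> \<gamma> ` {0..n} \<Longrightarrow> D \<le> disc x"
  shows "D * n / 8 \<le> total_cost"
proof -
  have "D / 2 * (C + 1) \<le> (8 * A + 1) * \<delta> * (C + 1)"
    using D C_nonneg by (intro mult_right_mono) auto
  then have "D / 2 * ((1 - \<epsilon>) * real (Suc n - 1) - C) \<le> (\<Sum>i=1..<Suc n. cost \<gamma> i)"
    using D \<delta>_le_c \<delta>_less_h edges by (intro walk_cost_ge lazy_walk_optimal range_subset_window) auto
  moreover have "\<epsilon> * n \<le> 1 / 2 * n" using \<epsilon>_le(1) by (intro mult_right_mono) auto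
  then have "real n / 4 \<le> (1 - \<epsilon>) * n - C" using C_le by (simp add: algebra_simps)
  then have "D / 2 * (real n / 4) \<le> D / 2 * ((1 - \<epsilon>) * n - C)"
    using D by (intro mult_left_mono) auto
  ultimately show ?thesis by (simp add: atLeastLessThanSuc_atLeastAtMost)
qed

lemma total_cost_ge_scale: "k * \<delta> * n / 8 \<le> total_cost"
proof (rule total_cost_ge)
  show "k * \<delta> \<le> (8 * A + 1) * \<delta>"
    using k(2) A_pos \<delta>_pos by (intro mult_right_mono) auto
qed (use k(1) \<delta>_pos disc_range_gt in \<open>auto intro: less_imp_le\<close>)

lemma disc_l_le: "disc l \<le> 8 * A * \<delta>"
proof (rule ccontr)
  assume "\<not> disc l \<le> 8 * A * \<delta>"
  define D where "D = min ((8 * A + 1) * \<delta>) (disc l)"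
  have D: "8 * A * \<delta> < D"
    using \<open>\<not> disc l \<le> 8 * A * \<delta>\<close> \<delta>_pos by (auto simp: D_def algebra_simps)
  have "D * n / 8 \<le> total_cost"
    using A_pos \<delta>_pos disc_nonneg[of l] l_min
    by (intro total_cost_ge) (auto simp: D_def min_le_iff_disj)
  moreover have "8 * A * \<delta> * n < D * n"
    using D n_pos by (intro mult_strict_right_mono) auto
  ultimately show False using total_cost_le by simp
qed

lemma abs_l_gt: "k * \<delta> * n < real_of_int \<bar>l\<bar>"
  using near_disc_lower disc_l_le by (force simp: discs_exceed_def mem_window_iff not_le[symmetric])

lemma disc_range_separated:
  assumes "x \<in> \<gamma> ` {0..n}" "2 \<le> \<bar>x - l\<bar>"
  shows "disc l + \<eta> * \<delta> \<le> disc x"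
proof (cases "disc x \<le> (8 * A + 1) * \<delta>")
  case True
  have "disc l \<le> (8 * A + 1) * \<delta>" using disc_l_le \<delta>_pos by (simp add: algebra_simps)
  moreover have "x \<in> window r" "l \<in> window r" using assms(1) l_mem range_subset_window by auto
  ultimately have "\<eta> * \<delta> < \<bar>disc x - disc l\<bar>"
    using separated assms(2) True unfolding small_discs_separated_def by blast
  then show ?thesis using l_min[OF assms(1)] by linarith
next
  case False
  moreover have "\<eta> * \<delta> \<le> 1 * \<delta>" using \<eta>(2) \<delta>_pos by (intro mult_right_mono) auto
  ultimately show ?thesis using disc_l_le by (simp add: algebra_simps)
qed

lemma stays_on_edge:
  assumes "hit_time \<gamma> l \<le> i" "i \<le> n"
  shows "\<gamma> i \<in> {l, l + 1}"
proof (rule ccontr)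
  assume "\<gamma> i \<notin> {l, l + 1}"
  then obtain s t where ex: "excursion n \<gamma> l s t"
    by (rule excursion_of_exit[OF l_mem assms])
  define D where "D = disc l + \<eta> * \<delta>"
  have "0 \<le> \<eta> * \<delta>" "\<eta> * \<delta> \<le> \<delta>"
    using \<eta> \<delta>_pos mult_left_le_one_le[of \<delta> \<eta>] by simp_all
  then have D: "disc l \<le> D" "D \<le> (8 * A + 1) * \<delta>"
    using disc_l_le unfolding D_def distrib_right by linarith+
  have "D * (C + 1) \<le> (8 * A + 1) * \<delta> * (C + 1)"
    using D(2) C_nonneg by (intro mult_right_mono) auto
  then have D_less_h: "D * (C + 1) < h" using \<delta>_less_h by linarith
  have "(\<Sum>i=Suc s..t. edge_cost c b f l i) < (\<Sum>i=Suc s..t. cost \<gamma> i)"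
  proof (rule excursion_cost_gt[OF lazy_walk_optimal range_subset_window abs_l_le _ ex])
    have "D * 1 \<le> D * (C + 1)" using D disc_nonneg[of l] C_nonneg by (intro mult_left_mono) auto
    then show "disc l < h" using D(1) D_less_h by simp
    have "\<epsilon> * (2 * disc l + \<eta> * \<delta>) \<le> \<epsilon> * (16 * A * \<delta> + \<eta> * \<delta>)"
      using disc_l_le eps_nonneg by (intro mult_left_mono) auto
    also have "\<dots> = 32 * A * \<epsilon> * (\<delta> / 2) + \<epsilon> * (\<eta> * \<delta>)" by (simp add: algebra_simps)
    also have "\<dots> \<le> \<eta> * (\<delta> / 2) + 1 / 2 * (\<eta> * \<delta>)"
      using \<epsilon>_le \<eta> \<delta>_pos by (intro add_mono mult_right_mono) auto
    finally show "(1 + \<epsilon>) * disc l \<le> (1 - \<epsilon>) * D" by (simp add: D_def algebra_simps)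
    have "disc l / 2 * C \<le> D / 2 * (C + 1)"
      using D(1) disc_nonneg[of l] C_nonneg by (intro mult_mono) auto
    then show "D / 2 * (C + 1) + disc l / 2 * C < h" using D_less_h by simp
    show "D \<le> disc x" if "x \<in> \<gamma> ` {0..n}" "2 \<le> \<bar>x - l\<bar>" for x
      using disc_range_separated[OF that] by (simp add: D_def)
  qed (use D \<delta>_le_c disc_nonneg[of l] in auto)
  then show False using optimal_excursion_cost_le[OF optimal ex, of c] by simp
qed

end

section \<open>The random environment\<close>

text \<open>The density bounds say that \<open>\<rho>\<close> behaves like \<open>(c - t) powr (\<alpha> - 1)\<close> at the right end of
  its support, up to constants; the paper's exponent is \<open>\<kappa> = \<alpha> - 1\<close>.\<close>
locale random_environment = prob_space M for M :: "'a measure" +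
  fixes F B :: "int \<Rightarrow> 'a \<Rightarrow> real" and \<rho> :: "real \<Rightarrow> real" and c \<alpha> q Q u :: real
  assumes c_pos: "0 < c" and \<alpha>_pos: "0 < \<alpha>" and q_pos: "0 < q" and Q_pos: "0 < Q" and u_pos: "0 < u"
    and indep: "indep_vars (\<lambda>_. borel) (\<lambda>k. case k of Inl x \<Rightarrow> F x | Inr i \<Rightarrow> B i) UNIV"
    and F_dist: "\<And>x. distributed M lborel (F x) (\<lambda>t. ennreal (\<rho> t))"
    and B_rv[measurable]: "\<And>i. B i \<in> borel_measurable M"
    and B_plus: "\<And>i. \<P>(\<omega> in M. B i \<omega> = 1) = 1 / 2"
    and B_minus: "\<And>i. \<P>(\<omega> in M. B i \<omega> = -1) = 1 / 2"
    and \<rho>_even: "\<And>t. \<rho> (- t) = \<rho> t"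
    and \<rho>_zero: "\<And>t. t \<notin> {-c<..<c} \<Longrightarrow> \<rho> t = 0"
    and \<rho>_ge: "\<And>s. 0 < s \<Longrightarrow> s \<le> u \<Longrightarrow> q * (\<alpha> * s powr (\<alpha> - 1)) \<le> \<rho> (c - s)"
    and \<rho>_le: "\<And>s. 0 < s \<Longrightarrow> s \<le> u \<Longrightarrow> \<rho> (c - s) \<le> Q * (\<alpha> * s powr (\<alpha> - 1))"
begin

abbreviation potential :: "'a \<Rightarrow> int \<Rightarrow> real" where
  "potential \<omega> \<equiv> \<lambda>x. F x \<omega>"

abbreviation signs :: "'a \<Rightarrow> int \<Rightarrow> real" where
  "signs \<omega> \<equiv> \<lambda>i. B i \<omega>"

abbreviation edge_disc :: "int \<Rightarrow> 'a \<Rightarrow> real" where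
  "edge_disc x \<omega> \<equiv> discrepancy c (potential \<omega>) x"

text \<open>For \<open>\<sigma> = \<plusminus>1\<close>, the distance of \<open>F x\<close> to the end \<open>\<sigma> * c\<close> of its support. A small discrepancy
  means that \<open>F\<close> is close to opposite ends at the two sites of the edge.\<close>
definition end_gap :: "real \<Rightarrow> int \<Rightarrow> 'a \<Rightarrow> real" where
  "end_gap \<sigma> x \<omega> = c - \<sigma> * F x \<omega>"

definition opposite_gaps :: "real \<Rightarrow> int \<Rightarrow> 'a \<Rightarrow> real" where
  "opposite_gaps \<sigma> x \<omega> = end_gap \<sigma> x \<omega> + end_gap (- \<sigma>) (x + 1) \<omega>"

lemma gap_eq_min: "gap c (potential \<omega>) x = min (end_gap 1 x \<omega>) (end_gap (-1) x \<omega>)"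
  by (simp add: gap_def end_gap_def)

lemma disc_eq_min: "edge_disc x \<omega> = min (opposite_gaps 1 x \<omega>) (opposite_gaps (-1) x \<omega>)"
  by (simp add: discrepancy_def opposite_gaps_def end_gap_def)

lemma F_rv[measurable]: "F x \<in> borel_measurable M"
  using distributed_measurable[OF F_dist[of x]] by simp

lemma gap_rv[measurable]: "(\<lambda>\<omega>. gap c (potential \<omega>) x) \<in> borel_measurable M"
  unfolding gap_def by measurable

lemma disc_rv[measurable]: "edge_disc x \<in> borel_measurable M"
  unfolding discrepancy_def by measurable

lemma end_gap_rv[measurable]: "end_gap \<sigma> x \<in> borel_measurable M"
  unfolding end_gap_def by measurable

lemma opposite_gaps_rv[measurable]: "opposite_gaps \<sigma> x \<in> borel_measurable M"
  unfolding opposite_gaps_def by measurable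

lemma indep_F: "indep_vars (\<lambda>_. borel) F UNIV"
  using indep_vars_reindex[OF indep, of Inl UNIV] by simp

lemma indep_B: "indep_vars (\<lambda>_. borel) B UNIV"
  using indep_vars_reindex[OF indep, of Inr UNIV] by simp

lemma indep_gap: "indep_vars (\<lambda>_. borel) (\<lambda>x \<omega>. gap c (potential \<omega>) x) UNIV"
  unfolding gap_def by (rule indep_vars_compose2[OF indep_F]) measurable

lemma indep_end_gap:
  assumes "x \<noteq> y"
  shows "indep_var borel (end_gap \<sigma> x) borel (end_gap \<tau> y)"
proof -
  have "indep_var borel ((\<lambda>t. c - \<sigma> * t) \<circ> F x) borel ((\<lambda>t. c - \<tau> * t) \<circ> F y)"
    by (rule indep_var_compose[OF indep_var_of_indep_vars[OF indep_F]]) (use assms in auto)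
  then show ?thesis by (simp add: comp_def end_gap_def[abs_def])
qed

lemma indep_disc:
  assumes I: "\<And>x y. x \<in> I \<Longrightarrow> y \<in> I \<Longrightarrow> x \<noteq> y \<Longrightarrow> 2 \<le> \<bar>x - y\<bar>"
  shows "indep_vars (\<lambda>_. borel) edge_disc I"
proof -
  have "{x, x + 1} \<inter> {y, y + 1} = {}" if "x \<in> I" "y \<in> I" "x \<noteq> y" for x y
    using I[OF that] by auto
  then have "disjoint_family_on (\<lambda>x. {x, x + 1}) I"
    by (simp add: disjoint_family_on_def)
  then have "indep_vars (\<lambda>_. borel)
      (\<lambda>x \<omega>. (\<lambda>g. 2 * c - \<bar>g (x + 1) - g x\<bar>) (restrict (\<lambda>y. F y \<omega>) {x, x + 1})) I"
    by (intro indep_vars_compose2[OF indep_vars_restrict[OF indep_F]])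
      (auto intro!: measurable_component_singleton borel_measurable_diff borel_measurable_abs)
  then show ?thesis by (simp add: discrepancy_def)
qed

lemma distributed_end_gap:
  assumes "\<sigma> \<in> {1, -1}"
  shows "distributed M lborel (end_gap \<sigma> x) (\<lambda>s. ennreal (\<rho> (c - s)))"
proof -
  have "distributed M lborel (\<lambda>\<omega>. c + (- \<sigma>) * F x \<omega>)
      (\<lambda>s. ennreal (\<rho> ((s - c) / - \<sigma>)) / ennreal \<bar>- \<sigma>\<bar>)"
    by (rule distributed_affine[OF F_dist]) (use assms in auto)
  moreover have "\<rho> ((s - c) / - \<sigma>) = \<rho> (c - s)" for s
    using assms \<rho>_even[of "c - s"] by auto
  ultimately show ?thesis using assms by (auto simp: end_gap_def[abs_def] divide_ennreal_def)
qed

lemma AE_end_gap_nonneg: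
  assumes "\<sigma> \<in> {1, -1}"
  shows "AE \<omega> in M. 0 \<le> end_gap \<sigma> x \<omega>"
proof (subst distributed_AE2[OF distributed_end_gap[OF assms]])
  have "0 \<le> s" if "0 < ennreal (\<rho> (c - s))" for s
    using that \<rho>_zero[of "c - s"] by (cases "0 \<le> s") auto
  then show "AE s in lborel. 0 < ennreal (\<rho> (c - s)) \<longrightarrow> 0 \<le> s" by simp
qed measurable

lemma AE_F_bound: "AE \<omega> in M. \<bar>F x \<omega>\<bar> \<le> c"
  using AE_end_gap_nonneg[of 1 x] AE_end_gap_nonneg[of "-1" x]
  by (auto simp: end_gap_def abs_le_iff)

lemma AE_B_sign: "AE \<omega> in M. B i \<omega> = 1 \<or> B i \<omega> = -1"
proof -
  have "\<P>(\<omega> in M. B i \<omega> = 1 \<or> B i \<omega> = -1) =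
      prob ({\<omega>\<in>space M. B i \<omega> = 1} \<union> {\<omega>\<in>space M. B i \<omega> = -1})"
    by (intro arg_cong[where f = prob]) auto
  also have "\<dots> = 1"
    by (subst finite_measure_Union) (auto simp: B_plus B_minus)
  finally show ?thesis by (subst (asm) prob_Collect_eq_1) auto
qed

lemma AE_bounded_potential: "AE \<omega> in M. bounded_potential c (signs \<omega>) (potential \<omega>)"
  unfolding bounded_potential_def using AE_F_bound AE_B_sign by (simp add: AE_all_countable)

lemma expectation_B: "expectation (B i) = 0"
proof -
  have "expectation (B i) =
      expectation (\<lambda>\<omega>. indicator {\<omega>\<in>space M. B i \<omega> = 1} \<omega> - indicator {\<omega>\<in>space M. B i \<omega> = -1} \<omega>)"
    by (rule integral_cong_AE) (use AE_B_sign[of i] in \<open>auto simp: indicator_def\<close>)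
  also have "\<dots> = \<P>(\<omega> in M. B i \<omega> = 1) - \<P>(\<omega> in M. B i \<omega> = -1)"
    by (subst Bochner_Integration.integral_diff)
      (auto simp: less_top[symmetric] intro!: integrable_real_indicator)
  finally show ?thesis by (simp add: B_plus B_minus)
qed

lemma prob_abs_sum_B_ge:
  assumes "finite I" "I \<noteq> {}" and "0 < \<epsilon>" "0 \<le> C"
  shows "\<P>(\<omega> in M. \<epsilon> * real (card I) + C \<le> \<bar>\<Sum>i\<in>I. B i \<omega>\<bar>) \<le> 2 * exp (- 2 * \<epsilon> * C)"
proof -
  define m where "m = real (card I)"
  have m: "0 < m" using assms by (simp add: m_def card_gt_0_iff)
  interpret Hoeffding_ineq M I B "\<lambda>_. -1" "\<lambda>_. 1" "\<Sum>i\<in>I. expectation (B i)"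
  proof unfold_locales
    show "indep_vars (\<lambda>_. borel) B I" by (rule indep_vars_subset[OF indep_B]) simp
    show "AE \<omega> in M. B i \<omega> \<in> {- 1..1}" for i using AE_B_sign[of i] by eventually_elim auto
  qed (use assms in auto)
  have width: "(\<Sum>i\<in>I. (1 - (- 1 :: real))\<^sup>2) = 4 * m" by (simp add: m_def)
  have "\<P>(\<omega> in M. \<epsilon> * m + C \<le> \<bar>(\<Sum>i\<in>I. B i \<omega>) - (\<Sum>i\<in>I. expectation (B i))\<bar>)
      \<le> 2 * exp (- 2 * (\<epsilon> * m + C)\<^sup>2 / (\<Sum>i\<in>I. (1 - (- 1))\<^sup>2))"
    using m assms(3,4) width by (intro Hoeffding_ineq_abs_ge) auto
  also have "\<dots> \<le> 2 * exp (- 2 * \<epsilon> * C)"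
  proof -
    \<comment> \<open>AM-GM makes the bound independent of the number of summands.\<close>
    have "4 * (\<epsilon> * m) * C \<le> (\<epsilon> * m + C)\<^sup>2"
      using sum_squares_bound[of "\<epsilon> * m" C] by (simp add: power2_sum mult.commute mult.left_commute)
    then show ?thesis unfolding width using m by (simp add: field_simps)
  qed
  finally show ?thesis by (simp add: expectation_B m_def)
qed

section \<open>Gaps and discrepancies near zero\<close>

lemma prob_end_gap_interval_le:
  assumes "\<sigma> \<in> {1, -1}" "0 \<le> v" "v \<le> w" "w \<le> u"
  shows "\<P>(\<omega> in M. end_gap \<sigma> x \<omega> \<in> {v..w}) \<le> Q * (w powr \<alpha> - v powr \<alpha>)"
proof (rule prob_interval_le_powr[OF distributed_end_gap \<alpha>_pos])
  show "\<rho> (c - s) \<le> Q * (\<alpha> * s powr (\<alpha> - 1))" if "s \<in> {v..w}" for s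
    using that assms \<rho>_le[of s] \<rho>_zero[of c] by (cases "s = 0") auto
qed (use assms Q_pos in auto)

lemma prob_end_gap_le:
  assumes "\<sigma> \<in> {1, -1}" "0 \<le> w" "w \<le> u"
  shows "\<P>(\<omega> in M. end_gap \<sigma> x \<omega> \<le> w) \<le> Q * w powr \<alpha>"
proof -
  have "\<P>(\<omega> in M. end_gap \<sigma> x \<omega> \<le> w) \<le> \<P>(\<omega> in M. end_gap \<sigma> x \<omega> \<in> {0..w})"
    by (rule finite_measure_mono_AE) (use AE_end_gap_nonneg[OF assms(1), of x] in auto)
  then show ?thesis using prob_end_gap_interval_le[of \<sigma> 0 w x] assms by simp
qed

lemma prob_end_gap_ge:
  assumes "\<sigma> \<in> {1, -1}" "0 \<le> w" "w \<le> u"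
  shows "q * w powr \<alpha> \<le> \<P>(\<omega> in M. end_gap \<sigma> x \<omega> \<le> w)"
proof -
  have "q * (w powr \<alpha> - 0 powr \<alpha>) \<le> \<P>(\<omega> in M. end_gap \<sigma> x \<omega> \<in> {0..w})"
  proof (rule prob_interval_ge_powr[OF distributed_end_gap \<alpha>_pos])
    show "q * (\<alpha> * s powr (\<alpha> - 1)) \<le> \<rho> (c - s)" if "s \<in> {0..w}" for s
      using that assms \<rho>_ge[of s] \<rho>_zero[of c] by (cases "s = 0") auto
  qed (use assms q_pos in auto)
  also have "\<dots> \<le> \<P>(\<omega> in M. end_gap \<sigma> x \<omega> \<le> w)" by (rule finite_measure_mono) auto
  finally show ?thesis by simp
qed

lemma prob_gap_le:
  assumes "0 \<le> w" "w \<le> u"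
  shows "\<P>(\<omega> in M. gap c (potential \<omega>) x \<le> w) \<le> 2 * Q * w powr \<alpha>"
proof -
  have "\<P>(\<omega> in M. end_gap 1 x \<omega> \<le> w \<or> end_gap (-1) x \<omega> \<le> w) \<le> Q * w powr \<alpha> + Q * w powr \<alpha>"
    using assms by (intro order_trans[OF prob_disj_le add_mono] prob_end_gap_le) auto
  then show ?thesis by (simp add: gap_eq_min min_le_iff_disj)
qed

lemma prob_gap_less:
  assumes "0 \<le> w" "w \<le> u"
  shows "\<P>(\<omega> in M. gap c (potential \<omega>) x < w) \<le> 2 * Q * w powr \<alpha>"
  by (rule order_trans[OF finite_measure_mono prob_gap_le[OF assms, of x]]) auto

lemma prob_pred_disc_le:
  assumes [measurable]: "Measurable.pred borel P"
    and p: "\<And>\<sigma>. \<sigma> \<in> {1, -1} \<Longrightarrow> \<P>(\<omega> in M. P (opposite_gaps \<sigma> x \<omega>)) \<le> p"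
  shows "\<P>(\<omega> in M. P (edge_disc x \<omega>)) \<le> 2 * p"
proof -
  have "\<P>(\<omega> in M. P (edge_disc x \<omega>)) \<le>
      \<P>(\<omega> in M. P (opposite_gaps 1 x \<omega>) \<or> P (opposite_gaps (-1) x \<omega>))"
    by (rule finite_measure_mono) (auto simp: disc_eq_min min_def split: if_splits)
  also have "\<dots> \<le> p + p"
    by (intro order_trans[OF prob_disj_le add_mono] p) auto
  finally show ?thesis by simp
qed

lemma AE_opposite_gaps_ge:
  assumes "\<sigma> \<in> {1, -1}"
  shows "AE \<omega> in M. 0 \<le> end_gap \<sigma> x \<omega> \<and> end_gap \<sigma> x \<omega> \<le> opposite_gaps \<sigma> x \<omega> \<and>
    0 \<le> end_gap (- \<sigma>) (x + 1) \<omega> \<and> end_gap (- \<sigma>) (x + 1) \<omega> \<le> opposite_gaps \<sigma> x \<omega>"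
proof -
  have "- \<sigma> \<in> {1, -1}" using assms by auto
  from AE_end_gap_nonneg[OF assms, of x] AE_end_gap_nonneg[OF this, of "x + 1"]
  show ?thesis by eventually_elim (simp add: opposite_gaps_def)
qed

lemma prob_disc_le:
  assumes "0 \<le> w" "w \<le> u"
  shows "\<P>(\<omega> in M. edge_disc x \<omega> \<le> w) \<le> 2 * (Q * w powr \<alpha>)\<^sup>2"
proof (rule prob_pred_disc_le)
  fix \<sigma> :: real assume \<sigma>: "\<sigma> \<in> {1, -1}"
  have "\<P>(\<omega> in M. opposite_gaps \<sigma> x \<omega> \<le> w) \<le>
      \<P>(\<omega> in M. end_gap \<sigma> x \<omega> \<in> {..w} \<and> end_gap (- \<sigma>) (x + 1) \<omega> \<in> {..w})"
    by (rule finite_measure_mono_AE) (use AE_opposite_gaps_ge[OF \<sigma>, of x] in auto)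
  also have "\<dots> = \<P>(\<omega> in M. end_gap \<sigma> x \<omega> \<in> {..w}) * \<P>(\<omega> in M. end_gap (- \<sigma>) (x + 1) \<omega> \<in> {..w})"
    by (rule prob_indep_random_variable[OF indep_end_gap]) auto
  also have "\<dots> \<le> (Q * w powr \<alpha>) * (Q * w powr \<alpha>)"
    unfolding atMost_iff using \<sigma> assms Q_pos by (intro mult_mono prob_end_gap_le) auto
  finally show "\<P>(\<omega> in M. opposite_gaps \<sigma> x \<omega> \<le> w) \<le> (Q * w powr \<alpha>)\<^sup>2"
    by (simp add: power2_eq_square)
qed measurable

lemma prob_disc_ge:
  assumes "0 \<le> w" "w \<le> 2 * u"
  shows "(q * (w / 2) powr \<alpha>)\<^sup>2 \<le> \<P>(\<omega> in M. edge_disc x \<omega> \<le> w)"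
proof -
  have "(q * (w / 2) powr \<alpha>)\<^sup>2 = (q * (w / 2) powr \<alpha>) * (q * (w / 2) powr \<alpha>)"
    by (simp add: power2_eq_square)
  also have "\<dots> \<le> \<P>(\<omega> in M. end_gap 1 x \<omega> \<in> {..w / 2}) *
      \<P>(\<omega> in M. end_gap (-1) (x + 1) \<omega> \<in> {..w / 2})"
    unfolding atMost_iff using assms q_pos by (intro mult_mono prob_end_gap_ge) auto
  also have "\<dots> = \<P>(\<omega> in M. end_gap 1 x \<omega> \<in> {..w / 2} \<and> end_gap (-1) (x + 1) \<omega> \<in> {..w / 2})"
    by (rule prob_indep_random_variable[OF indep_end_gap, symmetric]) auto
  also have "\<dots> \<le> \<P>(\<omega> in M. edge_disc x \<omega> \<le> w)"
    by (rule finite_measure_mono) (auto simp: disc_eq_min opposite_gaps_def min_le_iff_disj)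
  finally show ?thesis .
qed

text \<open>Bounds the increments of \<open>s powr \<alpha>\<close> over intervals of length \<open>2 * e\<close> in \<open>{0..w}\<close>.\<close>
definition increment_bound :: "real \<Rightarrow> real \<Rightarrow> real" where
  "increment_bound w e = max 1 \<alpha> * w powr (\<alpha> - min 1 \<alpha>) * (2 * e) powr min 1 \<alpha>"

lemma increment_bound_nonneg: "0 \<le> increment_bound w e"
  by (simp add: increment_bound_def)

lemma prob_end_gap_near:
  assumes \<sigma>: "\<sigma> \<in> {1, -1}" and w: "w \<le> u"
  shows "\<P>(\<omega> in M. end_gap \<sigma> x \<omega> \<in> {0..w} \<and> \<bar>end_gap \<sigma> x \<omega> - v\<bar> \<le> e) \<le> Q * increment_bound w e"
proof -
  define lo where "lo = max 0 (v - e)"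
  define hi where "hi = min w (v + e)"
  have "end_gap \<sigma> x \<omega> \<in> {0..w} \<and> \<bar>end_gap \<sigma> x \<omega> - v\<bar> \<le> e \<longleftrightarrow> end_gap \<sigma> x \<omega> \<in> {lo..hi}" for \<omega>
    by (auto simp: lo_def hi_def abs_le_iff)
  moreover have "\<P>(\<omega> in M. end_gap \<sigma> x \<omega> \<in> {lo..hi}) \<le> Q * increment_bound w e"
  proof (cases "lo \<le> hi")
    case True
    then have le: "0 \<le> lo" "hi \<le> w" "0 \<le> hi - lo" "hi - lo \<le> 2 * e" by (auto simp: lo_def hi_def)
    have "\<P>(\<omega> in M. end_gap \<sigma> x \<omega> \<in> {lo..hi}) \<le> Q * (hi powr \<alpha> - lo powr \<alpha>)"
      using True le w by (intro prob_end_gap_interval_le \<sigma>) auto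
    also have "hi powr \<alpha> - lo powr \<alpha> \<le> max 1 \<alpha> * w powr (\<alpha> - min 1 \<alpha>) * (hi - lo) powr min 1 \<alpha>"
      using True le by (intro powr_diff_le \<alpha>_pos) auto
    also have "\<dots> \<le> increment_bound w e"
      unfolding increment_bound_def using le \<alpha>_pos by (intro mult_left_mono powr_mono2) auto
    finally show ?thesis using Q_pos by simp
  next
    case False
    then have empty: "{\<omega>\<in>space M. end_gap \<sigma> x \<omega> \<in> {lo..hi}} = {}" by auto
    show ?thesis unfolding empty using Q_pos increment_bound_nonneg by simp
  qed
  ultimately show ?thesis by simp
qed

lemma prob_disc_near:
  assumes w: "0 \<le> w" "w \<le> u"
  shows "\<P>(\<omega> in M. edge_disc x \<omega> \<le> w \<and> \<bar>edge_disc x \<omega> - v\<bar> \<le> e) \<le>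
    2 * (Q * w powr \<alpha> * (Q * increment_bound w e))"
proof (rule prob_pred_disc_le)
  fix \<sigma> :: real assume \<sigma>: "\<sigma> \<in> {1, -1}"
  let ?X = "end_gap \<sigma> x" and ?Y = "end_gap (- \<sigma>) (x + 1)"
  have "\<P>(\<omega> in M. opposite_gaps \<sigma> x \<omega> \<le> w \<and> \<bar>opposite_gaps \<sigma> x \<omega> - v\<bar> \<le> e) \<le>
      \<P>(\<omega> in M. ?X \<omega> \<in> {..w} \<and> (?Y \<omega> \<in> {0..w} \<and> \<bar>?Y \<omega> - (v - ?X \<omega>)\<bar> \<le> e))"
    by (rule finite_measure_mono_AE)
      (use AE_opposite_gaps_ge[OF \<sigma>, of x] in \<open>auto simp: opposite_gaps_def algebra_simps\<close>)
  also have "\<dots> \<le> \<P>(\<omega> in M. ?X \<omega> \<in> {..w}) * (Q * increment_bound w e)"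
  proof (rule prob_indep_section_le[OF indep_end_gap])
    show "\<P>(\<omega> in M. ?Y \<omega> \<in> {0..w} \<and> \<bar>?Y \<omega> - (v - \<xi>)\<bar> \<le> e) \<le> Q * increment_bound w e" for \<xi>
      using \<sigma> w by (intro prob_end_gap_near) auto
  qed (use Q_pos increment_bound_nonneg in auto)
  also have "\<dots> \<le> Q * w powr \<alpha> * (Q * increment_bound w e)"
    unfolding atMost_iff using \<sigma> w Q_pos increment_bound_nonneg
    by (intro mult_right_mono prob_end_gap_le) auto
  finally show "\<P>(\<omega> in M. opposite_gaps \<sigma> x \<omega> \<le> w \<and> \<bar>opposite_gaps \<sigma> x \<omega> - v\<bar> \<le> e) \<le>
      Q * w powr \<alpha> * (Q * increment_bound w e)" .
qed measurable

lemma prob_disc_near_tie: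
  assumes w: "0 \<le> w" "w \<le> u" and xy: "2 \<le> \<bar>x - y\<bar>"
  shows "\<P>(\<omega> in M. edge_disc x \<omega> \<le> w \<and> edge_disc y \<omega> \<le> w \<and> \<bar>edge_disc x \<omega> - edge_disc y \<omega>\<bar> \<le> e) \<le>
    2 * (Q * w powr \<alpha>)\<^sup>2 * (2 * (Q * w powr \<alpha> * (Q * increment_bound w e)))"
proof -
  let ?p = "2 * (Q * w powr \<alpha> * (Q * increment_bound w e))"
  have p: "0 \<le> ?p" using Q_pos increment_bound_nonneg by simp
  have "indep_var borel (edge_disc x) borel (edge_disc y)"
    by (rule indep_var_of_indep_vars[OF indep_disc[of "{x, y}"]]) (use xy in auto)
  then have "\<P>(\<omega> in M. edge_disc x \<omega> \<in> {..w} \<and>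
      (edge_disc y \<omega> \<le> w \<and> \<bar>edge_disc y \<omega> - edge_disc x \<omega>\<bar> \<le> e)) \<le>
      \<P>(\<omega> in M. edge_disc x \<omega> \<in> {..w}) * ?p"
    by (rule prob_indep_section_le) (use p prob_disc_near[OF w] in auto)
  also have "\<dots> \<le> 2 * (Q * w powr \<alpha>)\<^sup>2 * ?p"
    unfolding atMost_iff by (intro mult_right_mono prob_disc_le w p)
  finally show ?thesis by (simp add: abs_minus_commute)
qed

section \<open>Probabilities of bad environments\<close>

lemma cheap_edge_within_measurable[measurable]:
  "Measurable.pred M (\<lambda>\<omega>. cheap_edge_within c (potential \<omega>) r w)"
  unfolding cheap_edge_within_def by measurable

lemma gap_sums_exceed_measurable[measurable]:
  "Measurable.pred M (\<lambda>\<omega>. gap_sums_exceed c (potential \<omega>) r w)"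
  unfolding gap_sums_exceed_def by measurable

lemma discs_exceed_measurable[measurable]:
  "Measurable.pred M (\<lambda>\<omega>. discs_exceed c (potential \<omega>) r w)"
  unfolding discs_exceed_def by measurable

lemma small_discs_separated_measurable[measurable]:
  "Measurable.pred M (\<lambda>\<omega>. small_discs_separated c (potential \<omega>) r w e)"
  unfolding small_discs_separated_def by measurable

lemma high_triple_free_measurable[measurable]:
  "Measurable.pred M (\<lambda>\<omega>. high_triple_free c (potential \<omega>) r h)"
  unfolding high_triple_free_def by measurable

lemma balanced_signs_measurable[measurable]:
  "Measurable.pred M (\<lambda>\<omega>. balanced_signs (signs \<omega>) n \<epsilon> C)"
  unfolding balanced_signs_def by measurable

lemma prob_not_cheap_edge_within:
  assumes w: "0 \<le> w" "w \<le> 2 * u" and r: "0 \<le> r"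
  shows "\<P>(\<omega> in M. \<not> cheap_edge_within c (potential \<omega>) r w) \<le>
    exp (- (r / 2 * (q * (w / 2) powr \<alpha>)\<^sup>2))"
proof -
  define p where "p = (q * (w / 2) powr \<alpha>)\<^sup>2"
  define J where "J = (\<lambda>j. 2 * j) ` {0..\<lfloor>r / 2\<rfloor>}"
  have "card J = nat (\<lfloor>r / 2\<rfloor> + 1)"
    unfolding J_def by (subst card_image) (auto simp: inj_on_def)
  then have card_J: "r / 2 \<le> real (card J)" using r by linarith
  have "J \<subseteq> {0..\<lfloor>r\<rfloor>}" by (auto simp: J_def le_floor_iff)
  then have "\<P>(\<omega> in M. \<not> cheap_edge_within c (potential \<omega>) r w) \<le>
      \<P>(\<omega> in M. \<forall>x\<in>J. edge_disc x \<omega> \<in> {w<..})"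
    by (intro finite_measure_mono) (auto simp: cheap_edge_within_def not_le J_def)
  also have "\<dots> \<le> exp (- p) ^ card J"
  proof (rule prob_indep_Ball_le_power[OF indep_disc[where I = J]])
    fix x
    have "\<P>(\<omega> in M. edge_disc x \<omega> \<in> {w<..}) = 1 - \<P>(\<omega> in M. edge_disc x \<omega> \<le> w)"
      using prob_neg[of "\<lambda>\<omega>. edge_disc x \<omega> \<le> w"] by (simp add: not_le)
    also have "\<dots> \<le> 1 - p" using prob_disc_ge[OF w, of x] by (simp add: p_def)
    also have "\<dots> \<le> exp (- p)" using exp_ge_add_one_self[of "- p"] by simp
    finally show "\<P>(\<omega> in M. edge_disc x \<omega> \<in> {w<..}) \<le> exp (- p)" .
  qed (auto simp: J_def)
  also have "\<dots> = exp (- (real (card J) * p))" by (simp flip: exp_of_nat_mult)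
  also have "\<dots> \<le> exp (- (r / 2 * p))"
    using mult_right_mono[OF card_J, of p] by (simp add: p_def)
  finally show ?thesis by (simp add: p_def)
qed

lemma prob_gap_sum_le:
  assumes X: "finite X" "X \<noteq> {}" and w: "0 < w" "w \<le> u"
  shows "\<P>(\<omega> in M. (\<Sum>x\<in>X. gap c (potential \<omega>) x) \<le> w * real (card X) / 2) \<le> 4 * Q * w powr \<alpha>"
proof -
  define N where "N \<omega> = real (card {x\<in>X. gap c (potential \<omega>) x < w})" for \<omega>
  have X_pos: "0 < real (card X)" using X by (simp add: card_gt_0_iff)
  have N_eq: "N \<omega> = (\<Sum>x\<in>X. if gap c (potential \<omega>) x < w then 1 else 0)" for \<omega>
    using X(1) by (simp add: N_def sum.If_cases Int_def)
  have gap_sum_ge: "w * (real (card X) - N \<omega>) \<le> (\<Sum>x\<in>X. gap c (potential \<omega>) x)"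
    if "bounded_potential c (signs \<omega>) (potential \<omega>)" for \<omega>
  proof -
    have "w * (real (card X) - N \<omega>) =
        (\<Sum>x\<in>X. w * (1 - (if gap c (potential \<omega>) x < w then 1 else 0)))"
      by (simp add: N_eq sum_subtractf flip: sum_distrib_left)
    also have "\<dots> \<le> (\<Sum>x\<in>X. gap c (potential \<omega>) x)"
      using bounded_potential.gap_nonneg[OF that] by (intro sum_mono) simp
    finally show ?thesis .
  qed
  have "real (card X) / 2 \<le> N \<omega>"
    if "bounded_potential c (signs \<omega>) (potential \<omega>)"
      "(\<Sum>x\<in>X. gap c (potential \<omega>) x) \<le> w * real (card X) / 2" for \<omega>
  proof -
    have "w * (real (card X) - N \<omega>) \<le> w * (real (card X) / 2)"
      using that(2) gap_sum_ge[OF that(1)] by simp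
    then show ?thesis using w(1) by simp
  qed
  then have "\<P>(\<omega> in M. (\<Sum>x\<in>X. gap c (potential \<omega>) x) \<le> w * real (card X) / 2) \<le>
      \<P>(\<omega> in M. real (card X) / 2 \<le> N \<omega>)"
    using AE_bounded_potential by (intro finite_measure_mono_AE) (auto simp: N_eq)
  also have "\<dots> \<le> real (card X) * (2 * Q * w powr \<alpha>) / (real (card X) / 2)"
    unfolding N_def using X_pos X(1) w by (intro prob_card_ge_le prob_gap_less) auto
  also have "\<dots> = 4 * Q * w powr \<alpha>" using X_pos by (simp add: field_simps)
  finally show ?thesis .
qed

lemma prob_not_gap_sums_exceed:
  assumes w: "0 < w" "w \<le> u" and r: "1 \<le> r" "a \<le> w * of_int \<lfloor>r\<rfloor> / 2"
  shows "\<P>(\<omega> in M. \<not> gap_sums_exceed c (potential \<omega>) r a) \<le> 8 * Q * w powr \<alpha>"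
proof -
  have "\<P>(\<omega> in M. (\<Sum>x\<in>X. gap c (potential \<omega>) x) \<le> a) \<le> 4 * Q * w powr \<alpha>"
    if "X = {1..\<lfloor>r\<rfloor>} \<or> X = {- \<lfloor>r\<rfloor>..-1}" for X
  proof -
    have X: "finite X" "X \<noteq> {}" "real (card X) = of_int \<lfloor>r\<rfloor>"
      using that r(1) by (auto simp: le_floor_iff of_nat_nat)
    have "\<P>(\<omega> in M. (\<Sum>x\<in>X. gap c (potential \<omega>) x) \<le> a) \<le>
        \<P>(\<omega> in M. (\<Sum>x\<in>X. gap c (potential \<omega>) x) \<le> w * real (card X) / 2)"
      using r(2) X(3) by (intro finite_measure_mono) auto
    also have "\<dots> \<le> 4 * Q * w powr \<alpha>" by (rule prob_gap_sum_le[OF X(1,2) w])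
    finally show ?thesis .
  qed
  then have "\<P>(\<omega> in M. (\<Sum>x\<in>{1..\<lfloor>r\<rfloor>}. gap c (potential \<omega>) x) \<le> a \<or>
      (\<Sum>x\<in>{- \<lfloor>r\<rfloor>..-1}. gap c (potential \<omega>) x) \<le> a) \<le> 4 * Q * w powr \<alpha> + 4 * Q * w powr \<alpha>"
    by (intro order_trans[OF prob_disj_le add_mono]) auto
  then show ?thesis by (simp add: gap_sums_exceed_def not_less)
qed

lemma prob_not_discs_exceed:
  assumes "0 \<le> w" "w \<le> u" "1 \<le> r"
  shows "\<P>(\<omega> in M. \<not> discs_exceed c (potential \<omega>) r w) \<le> 6 * r * (Q * w powr \<alpha>)\<^sup>2"
proof -
  have "\<P>(\<omega> in M. \<exists>x\<in>window r. edge_disc x \<omega> \<le> w) \<le> real (card (window r)) * (2 * (Q * w powr \<alpha>)\<^sup>2)"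
    using assms by (intro prob_Bex_le finite_window prob_disc_le) auto
  also have "\<dots> \<le> 3 * r * (2 * (Q * w powr \<alpha>)\<^sup>2)"
    using card_window_le[OF assms(3)] by (intro mult_right_mono) auto
  finally show ?thesis by (simp add: discs_exceed_def not_less)
qed

lemma prob_not_small_discs_separated:
  assumes w: "0 \<le> w" "w \<le> u" and r: "1 \<le> r"
  shows "\<P>(\<omega> in M. \<not> small_discs_separated c (potential \<omega>) r w e) \<le>
    36 * (r * Q\<^sup>2)\<^sup>2 * (w powr \<alpha>) ^ 3 * increment_bound w e"
proof -
  let ?tie = "\<lambda>z \<omega>. 2 \<le> \<bar>fst z - snd z\<bar> \<and> edge_disc (fst z) \<omega> \<le> w \<and> edge_disc (snd z) \<omega> \<le> w \<and>
    \<bar>edge_disc (fst z) \<omega> - edge_disc (snd z) \<omega>\<bar> \<le> e"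
  let ?p = "2 * (Q * w powr \<alpha>)\<^sup>2 * (2 * (Q * w powr \<alpha> * (Q * increment_bound w e)))"
  have p: "0 \<le> ?p" using Q_pos increment_bound_nonneg by simp
  have tie: "\<P>(\<omega> in M. ?tie z \<omega>) \<le> ?p" for z
  proof (cases "2 \<le> \<bar>fst z - snd z\<bar>")
    case True
    then show ?thesis using prob_disc_near_tie[OF w True] by simp
  next
    case False
    then show ?thesis using p by simp
  qed
  have "\<P>(\<omega> in M. \<not> small_discs_separated c (potential \<omega>) r w e) =
      \<P>(\<omega> in M. \<exists>z\<in>window r \<times> window r. ?tie z \<omega>)"
    by (simp add: small_discs_separated_def not_less)
  also have "\<dots> \<le> real (card (window r \<times> window r)) * ?p"
    by (intro prob_Bex_le tie finite_cartesian_product finite_window) measurable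
  also have "\<dots> \<le> (3 * r)\<^sup>2 * ?p"
    using card_window_le[OF r] r
    unfolding card_cartesian_product of_nat_mult power2_eq_square[of "3 * r"]
    by (intro mult_right_mono p mult_mono) auto
  also have "\<dots> = 36 * (r * Q\<^sup>2)\<^sup>2 * (w powr \<alpha>) ^ 3 * increment_bound w e"
    by (simp add: power2_eq_square power3_eq_cube)
  finally show ?thesis .
qed

lemma prob_not_high_triple_free:
  assumes h: "0 \<le> h" "h \<le> u" and r: "1 \<le> r"
  shows "\<P>(\<omega> in M. \<not> high_triple_free c (potential \<omega>) r h) \<le> 3 * r * (2 * Q * h powr \<alpha>) ^ 3"
proof -
  have "\<P>(\<omega> in M. \<exists>x\<in>window r. \<forall>y\<in>{x - 1, x, x + 1}. gap c (potential \<omega>) y \<in> {..<h}) \<le>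
      real (card (window r)) * (2 * Q * h powr \<alpha>) ^ 3"
  proof (rule prob_Bex_le[OF finite_window])
    show "\<P>(\<omega> in M. \<forall>y\<in>{x - 1, x, x + 1}. gap c (potential \<omega>) y \<in> {..<h}) \<le>
        (2 * Q * h powr \<alpha>) ^ 3" for x
    proof -
      have "\<P>(\<omega> in M. \<forall>y\<in>{x - 1, x, x + 1}. gap c (potential \<omega>) y \<in> {..<h}) \<le>
          (2 * Q * h powr \<alpha>) ^ card {x - 1, x, x + 1}"
        by (rule prob_indep_Ball_le_power[OF indep_gap]) (auto simp: prob_gap_less[OF h])
      moreover have "card {x - 1, x, x + 1} = 3" by simp
      ultimately show ?thesis by (simp only:)
    qed
  qed measurable
  also have "\<dots> \<le> 3 * r * (2 * Q * h powr \<alpha>) ^ 3"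
    using card_window_le[OF r] Q_pos by (intro mult_right_mono) auto
  finally show ?thesis by (simp add: high_triple_free_def not_le)
qed

lemma prob_not_balanced_signs:
  assumes "0 < \<epsilon>" "0 \<le> C"
  shows "\<P>(\<omega> in M. \<not> balanced_signs (signs \<omega>) n \<epsilon> C) \<le> (real n + 2)\<^sup>2 * (2 * exp (- 2 * \<epsilon> * C))"
proof -
  let ?large = "\<lambda>z \<omega>. fst z < snd z \<and>
    \<epsilon> * real (snd z - fst z) + C \<le> \<bar>\<Sum>i=fst z..<snd z. B (int i) \<omega>\<bar>"
  have large: "\<P>(\<omega> in M. ?large z \<omega>) \<le> 2 * exp (- 2 * \<epsilon> * C)" for z :: "nat \<times> nat"
  proof (cases "fst z < snd z")
    case True
    define I where "I = int ` {fst z..<snd z}"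
    have I: "finite I" "I \<noteq> {}" "card I = snd z - fst z"
      using True by (auto simp: I_def card_image)
    have "(\<Sum>i=fst z..<snd z. B (int i) \<omega>) = (\<Sum>i\<in>I. B i \<omega>)" for \<omega>
      by (simp add: I_def sum.reindex)
    then show ?thesis using prob_abs_sum_B_ge[OF I(1,2) assms] I(3) True by simp
  qed simp
  have "\<P>(\<omega> in M. \<not> balanced_signs (signs \<omega>) n \<epsilon> C) =
      \<P>(\<omega> in M. \<exists>z\<in>{..Suc n} \<times> {..Suc n}. ?large z \<omega>)"
    by (simp add: balanced_signs_def not_less cong: conj_cong)
  also have "\<dots> \<le> real (card ({..Suc n} \<times> {..Suc n})) * (2 * exp (- 2 * \<epsilon> * C))"
    by (intro prob_Bex_le large finite_cartesian_product) auto
  finally show ?thesis by (simp add: card_cartesian_product power2_eq_square algebra_simps)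
qed

section \<open>Typical environments at large scales\<close>

definition \<zeta> :: real where "\<zeta> = 2 * \<alpha> / (2 * \<alpha> + 1)"

definition range_scale :: "nat \<Rightarrow> real" where "range_scale n = real n powr \<zeta>"

definition disc_scale :: "nat \<Rightarrow> real" where "disc_scale n = real n powr (\<zeta> - 1)"

text \<open>The exponent of \<open>height\<close> lies between \<open>2/3\<close> and \<open>1\<close> times that of \<open>disc_scale\<close>: above
  \<open>2/3\<close> triples of high sites disappear, below \<open>1\<close> there is room for a factor \<open>slack\<close> between
  \<open>disc_scale\<close> and \<open>height\<close>.\<close>
definition height :: "nat \<Rightarrow> real" where "height n = real n powr ((\<zeta> - 1) * (5 / 6))"

definition slack :: "nat \<Rightarrow> real" where "slack n = real n powr ((1 - \<zeta>) / 12)"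

lemma zeta_pos: "0 < \<zeta>" and zeta_less_1: "\<zeta> < 1" and zeta_eq: "(\<zeta> - 1) * (2 * \<alpha>) = - \<zeta>"
  using \<alpha>_pos by (auto simp: \<zeta>_def field_simps)

lemma slack_nonneg: "0 \<le> slack n"
  by (simp add: slack_def)

lemma disc_scale_pos: "0 < n \<Longrightarrow> 0 < disc_scale n"
  by (simp add: disc_scale_def)

lemma disc_scale_mult: "disc_scale n * real n = range_scale n"
  using powr_mult_base[of "real n" "\<zeta> - 1"]
  by (simp add: disc_scale_def range_scale_def mult.commute)

lemma range_scale_disc_scale:
  assumes "0 < n"
  shows "range_scale n * (disc_scale n powr \<alpha>)\<^sup>2 = 1"
proof -
  have "(disc_scale n powr \<alpha>)\<^sup>2 = real n powr ((\<zeta> - 1) * (2 * \<alpha>))"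
    by (simp add: disc_scale_def power2_eq_square powr_powr algebra_simps flip: powr_add)
  then show ?thesis using assms unfolding zeta_eq by (simp add: range_scale_def flip: powr_add)
qed

lemma increment_bound_scale:
  "increment_bound (w * d) (e * d) = increment_bound w e * d powr \<alpha>"
proof -
  have "d powr (\<alpha> - min 1 \<alpha>) * d powr min 1 \<alpha> = d powr \<alpha>" by (simp flip: powr_add)
  then show ?thesis
    by (simp add: increment_bound_def powr_mult mult_ac flip: mult.assoc[of 2 e d])
qed

lemma disc_scale_tendsto_0: "disc_scale \<longlonglongrightarrow> 0"
  unfolding disc_scale_def using zeta_less_1 by real_asymp

lemma eventually_disc_scale_le: "0 < e \<Longrightarrow> \<forall>\<^sub>F n in sequentially. k * disc_scale n \<le> e"
  using order_tendstoD(2)[OF tendsto_mult_right_zero[OF disc_scale_tendsto_0, of k], of e]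
  by (auto elim!: eventually_mono)

lemma eventually_range_scale_ge: "\<forall>\<^sub>F n in sequentially. k \<le> range_scale n"
proof -
  have "filterlim range_scale at_top sequentially"
    unfolding range_scale_def using zeta_pos by real_asymp
  then show ?thesis by (simp add: filterlim_at_top)
qed

lemma eventually_mult_range_scale_ge:
  "0 < m \<Longrightarrow> \<forall>\<^sub>F n in sequentially. k \<le> m * range_scale n"
  using eventually_range_scale_ge[of "k / m"] by (auto elim!: eventually_mono simp: field_simps)

lemma eventually_height_le: "0 < e \<Longrightarrow> \<forall>\<^sub>F n in sequentially. height n \<le> e"
proof -
  assume "0 < e"
  have "height \<longlonglongrightarrow> 0" unfolding height_def using zeta_less_1 by real_asymp
  from order_tendstoD(2)[OF this \<open>0 < e\<close>] show ?thesis by (auto elim!: eventually_mono)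
qed

lemma eventually_slack_le: "\<forall>\<^sub>F n in sequentially. slack n \<le> real n / 4"
proof -
  have "(\<lambda>n. slack n / real n) \<longlonglongrightarrow> 0"
    unfolding slack_def using zeta_pos by real_asymp
  then have "\<forall>\<^sub>F n in sequentially. slack n / real n < 1 / 4" by (rule order_tendstoD) simp
  with eventually_gt_at_top[of 0] show ?thesis
    by eventually_elim (simp add: field_simps)
qed

lemma eventually_disc_scale_less_height:
  "\<forall>\<^sub>F n in sequentially. k * disc_scale n * (slack n + 1) < height n"
proof -
  define s where "s = (1 - \<zeta>) / 12"
  have s: "0 < s" "1 - \<zeta> = 12 * s" using zeta_less_1 by (auto simp: s_def)
  have "(\<lambda>n. k * disc_scale n * (slack n + 1) / height n) \<longlonglongrightarrow> 0"
  proof -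
    have "(\<lambda>n. k * real n powr (- (12 * s)) * (real n powr s + 1) / real n powr (- (10 * s))) \<longlonglongrightarrow> 0"
      using s(1) by real_asymp
    moreover have "\<zeta> - 1 = - (12 * s)" "(\<zeta> - 1) * (5 / 6) = - (10 * s)" "(1 - \<zeta>) / 12 = s"
      using s(2) by auto
    ultimately show ?thesis unfolding disc_scale_def slack_def height_def by (simp only:)
  qed
  then have "\<forall>\<^sub>F n in sequentially. k * disc_scale n * (slack n + 1) / height n < 1"
    by (rule order_tendstoD) simp
  with eventually_gt_at_top[of 0] show ?thesis
    by eventually_elim (simp add: height_def field_simps)
qed

lemma eventually_prob_not_cheap_edge_within:
  assumes "0 < k"
  shows "\<forall>\<^sub>F n in sequentially.
    \<P>(\<omega> in M. \<not> cheap_edge_within c (potential \<omega>) (range_scale n) (k * disc_scale n)) \<le>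
      exp (- ((q * (k / 2) powr \<alpha>)\<^sup>2 / 2))"
proof -
  have "0 < 2 * u" using u_pos by simp
  from eventually_disc_scale_le[OF this, of k] eventually_gt_at_top[of 0] show ?thesis
  proof eventually_elim
    case (elim n)
    have "\<P>(\<omega> in M. \<not> cheap_edge_within c (potential \<omega>) (range_scale n) (k * disc_scale n)) \<le>
        exp (- (range_scale n / 2 * (q * (k * disc_scale n / 2) powr \<alpha>)\<^sup>2))"
      using elim assms disc_scale_pos[of n]
      by (intro prob_not_cheap_edge_within) (auto simp: range_scale_def)
    also have "(k * disc_scale n / 2) powr \<alpha> = (k / 2) powr \<alpha> * disc_scale n powr \<alpha>"
      by (simp add: powr_mult[symmetric])
    also have "range_scale n / 2 * (q * \<dots>)\<^sup>2 =
        (q * (k / 2) powr \<alpha>)\<^sup>2 / 2 * (range_scale n * (disc_scale n powr \<alpha>)\<^sup>2)"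
      by (simp add: power_mult_distrib)
    finally show ?case using range_scale_disc_scale elim by simp
  qed
qed

lemma eventually_prob_not_gap_sums_exceed:
  assumes w: "0 < w" "w \<le> u" and "0 < m" "a < w * m / 2"
  shows "\<forall>\<^sub>F n in sequentially.
    \<P>(\<omega> in M. \<not> gap_sums_exceed c (potential \<omega>) (m * range_scale n) (a * range_scale n)) \<le>
      8 * Q * w powr \<alpha>"
proof -
  have "0 < w * m / 2 - a" using assms(4) by simp
  from eventually_mult_range_scale_ge[OF assms(3), of 1]
    eventually_mult_range_scale_ge[OF this, of "w / 2"]
  show ?thesis
  proof eventually_elim
    case (elim n)
    have "a * range_scale n \<le> w * (m * range_scale n - 1) / 2"
      using elim by (simp add: algebra_simps)
    also have "\<dots> \<le> w * of_int \<lfloor>m * range_scale n\<rfloor> / 2"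
      using w(1) by (intro divide_right_mono mult_left_mono) linarith+
    finally show ?case using elim by (intro prob_not_gap_sums_exceed w) auto
  qed
qed

lemma eventually_prob_not_discs_exceed:
  assumes "0 < m" "0 \<le> k"
  shows "\<forall>\<^sub>F n in sequentially.
    \<P>(\<omega> in M. \<not> discs_exceed c (potential \<omega>) (m * range_scale n) (k * disc_scale n)) \<le>
      6 * m * (Q * k powr \<alpha>)\<^sup>2"
  using eventually_mult_range_scale_ge[OF assms(1), of 1] eventually_disc_scale_le[OF u_pos, of k]
    eventually_gt_at_top[of 0]
proof eventually_elim
  case (elim n)
  have "\<P>(\<omega> in M. \<not> discs_exceed c (potential \<omega>) (m * range_scale n) (k * disc_scale n)) \<le>
      6 * (m * range_scale n) * (Q * (k * disc_scale n) powr \<alpha>)\<^sup>2"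
    using elim assms(2) disc_scale_pos[of n] by (intro prob_not_discs_exceed) auto
  also have "\<dots> = 6 * m * (Q * k powr \<alpha>)\<^sup>2 * (range_scale n * (disc_scale n powr \<alpha>)\<^sup>2)"
    by (simp add: powr_mult power_mult_distrib)
  also have "\<dots> = 6 * m * (Q * k powr \<alpha>)\<^sup>2"
    using range_scale_disc_scale elim by simp
  finally show ?case .
qed

lemma eventually_prob_not_small_discs_separated:
  assumes "0 < m" "0 \<le> k"
  shows "\<forall>\<^sub>F n in sequentially.
    \<P>(\<omega> in M. \<not> small_discs_separated c (potential \<omega>)
        (m * range_scale n) (k * disc_scale n) (\<eta> * disc_scale n)) \<le>
      36 * (m * Q\<^sup>2)\<^sup>2 * (k powr \<alpha>) ^ 3 * increment_bound k \<eta>"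
  using eventually_mult_range_scale_ge[OF assms(1), of 1] eventually_disc_scale_le[OF u_pos, of k]
    eventually_gt_at_top[of 0]
proof eventually_elim
  case (elim n)
  let ?d = "disc_scale n" and ?r = "range_scale n"
  have d: "0 < ?d" using elim disc_scale_pos by simp
  have "\<P>(\<omega> in M. \<not> small_discs_separated c (potential \<omega>) (m * ?r) (k * ?d) (\<eta> * ?d)) \<le>
      36 * (m * ?r * Q\<^sup>2)\<^sup>2 * ((k * ?d) powr \<alpha>) ^ 3 * increment_bound (k * ?d) (\<eta> * ?d)"
    using elim assms(2) d by (intro prob_not_small_discs_separated) auto
  also have "\<dots> =
      36 * (m * Q\<^sup>2)\<^sup>2 * (k powr \<alpha>) ^ 3 * increment_bound k \<eta> * (?r * (?d powr \<alpha>)\<^sup>2)\<^sup>2"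
    by (simp add: increment_bound_scale powr_mult power_mult_distrib
        power2_eq_square power3_eq_cube mult_ac)
  also have "\<dots> = 36 * (m * Q\<^sup>2)\<^sup>2 * (k powr \<alpha>) ^ 3 * increment_bound k \<eta>"
    using range_scale_disc_scale elim by simp
  finally show ?case .
qed

lemma eventually_prob_not_high_triple_free:
  assumes "0 < m" "0 < e"
  shows "\<forall>\<^sub>F n in sequentially.
    \<P>(\<omega> in M. \<not> high_triple_free c (potential \<omega>) (m * range_scale n + 1) (height n)) \<le> e"
proof -
  have "(\<lambda>n. 3 * (m * real n powr \<zeta> + 1) * (8 * Q ^ 3 * real n powr (- (5 / 4 * \<zeta>)))) \<longlonglongrightarrow> 0"
    using zeta_pos by real_asymp
  from order_tendstoD(2)[OF this assms(2)] eventually_height_le[OF u_pos]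
    eventually_mult_range_scale_ge[OF assms(1), of 1] eventually_gt_at_top[of 0]
  show ?thesis
  proof eventually_elim
    case (elim n)
    have "(height n powr \<alpha>) ^ 3 = real n powr ((\<zeta> - 1) * (5 / 6) * \<alpha> * 3)"
      using elim(4) by (simp add: height_def powr_powr powr_numeral[symmetric] del: powr_numeral)
    also have "(\<zeta> - 1) * (5 / 6) * \<alpha> * 3 = - (5 / 4 * \<zeta>)"
      using zeta_eq by (simp add: algebra_simps)
    finally have "3 * (m * range_scale n + 1) * (2 * Q * height n powr \<alpha>) ^ 3 < e"
      using elim(1) by (simp add: range_scale_def power_mult_distrib mult_ac)
    then show ?case
      using prob_not_high_triple_free[of "height n" "m * range_scale n + 1"] elim(2,3)
      by (simp add: height_def)
  qed
qed

lemma eventually_prob_not_balanced_signs: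
  assumes "0 < \<epsilon>" "0 < e"
  shows "\<forall>\<^sub>F n in sequentially. \<P>(\<omega> in M. \<not> balanced_signs (signs \<omega>) n \<epsilon> (slack n)) \<le> e"
proof -
  define s where "s = (1 - \<zeta>) / 12"
  have "0 < s" using zeta_less_1 by (simp add: s_def)
  then have "(\<lambda>n. (real n + 2)\<^sup>2 * (2 * exp (- 2 * \<epsilon> * slack n))) \<longlonglongrightarrow> 0"
    unfolding slack_def s_def[symmetric] using assms(1) by real_asymp
  from order_tendstoD(2)[OF this assms(2)] show ?thesis
  proof eventually_elim
    case (elim n)
    then show ?case
      using prob_not_balanced_signs[OF assms(1) slack_nonneg[of n], of n] by linarith
  qed
qed

definition typical :: "real \<Rightarrow> real \<Rightarrow> real \<Rightarrow> real \<Rightarrow> real \<Rightarrow> nat \<Rightarrow> 'a \<Rightarrow> bool" where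
  "typical A k m \<eta> \<epsilon> n \<omega> \<longleftrightarrow>
    cheap_edge_within c (potential \<omega>) (range_scale n) ((A - 2 * c) * disc_scale n) \<and>
    gap_sums_exceed c (potential \<omega>) (m * range_scale n) (A * range_scale n) \<and>
    discs_exceed c (potential \<omega>) (m * range_scale n) (k * disc_scale n) \<and>
    discs_exceed c (potential \<omega>) (k * range_scale n) (8 * A * disc_scale n) \<and>
    small_discs_separated c (potential \<omega>) (m * range_scale n)
      ((8 * A + 1) * disc_scale n) (\<eta> * disc_scale n) \<and>
    high_triple_free c (potential \<omega>) (m * range_scale n + 1) (height n) \<and>
    balanced_signs (signs \<omega>) n \<epsilon> (slack n)"

lemma typical_measurable[measurable]: "Measurable.pred M (typical A k m \<eta> \<epsilon> n)"
  unfolding typical_def by measurable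

lemma eventually_prob_not_typical:
  assumes "0 < e" "2 * c < A" "0 < w" "w \<le> u" "0 < m" "A < w * m / 2" "0 < k" "0 < \<epsilon>"
    and "exp (- ((q * ((A - 2 * c) / 2) powr \<alpha>)\<^sup>2 / 2)) \<le> e"
    and "8 * Q * w powr \<alpha> \<le> e"
    and "6 * m * (Q * k powr \<alpha>)\<^sup>2 \<le> e"
    and "6 * k * (Q * (8 * A) powr \<alpha>)\<^sup>2 \<le> e"
    and "36 * (m * Q\<^sup>2)\<^sup>2 * ((8 * A + 1) powr \<alpha>) ^ 3 * increment_bound (8 * A + 1) \<eta> \<le> e"
  shows "\<forall>\<^sub>F n in sequentially. \<P>(\<omega> in M. \<not> typical A k m \<eta> \<epsilon> n \<omega>) \<le> 7 * e"
proof -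
  have A: "0 < A - 2 * c" "0 \<le> 8 * A" "0 \<le> 8 * A + 1" using assms(2) c_pos by auto
  show ?thesis
    using eventually_prob_not_cheap_edge_within[OF A(1)]
      eventually_prob_not_gap_sums_exceed[OF assms(3-6)]
      eventually_prob_not_discs_exceed[OF assms(5) less_imp_le[OF assms(7)]]
      eventually_prob_not_discs_exceed[OF assms(7) A(2)]
      eventually_prob_not_small_discs_separated[OF assms(5) A(3), where \<eta> = \<eta>]
      eventually_prob_not_high_triple_free[OF assms(5,1)]
      eventually_prob_not_balanced_signs[OF assms(8,1)]
  proof eventually_elim
    case (elim n)
    have "\<P>(\<omega> in M. \<not> typical A k m \<eta> \<epsilon> n \<omega>) \<le> e + (e + (e + (e + (e + (e + e)))))"
      unfolding typical_def de_Morgan_conj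
      by (intro order_trans[OF prob_disj_le add_mono]
          order_trans[OF elim(1)] order_trans[OF elim(2)] order_trans[OF elim(3)]
          order_trans[OF elim(4)] order_trans[OF elim(5)] elim(6,7) assms(9-13)) measurable
    then show ?case by simp
  qed
qed

lemma ex_typical_constants:
  assumes "0 < e"
  shows "\<exists>A k m \<eta> \<epsilon>. 0 < A \<and> 0 < k \<and> k \<le> 1 \<and> 0 < m \<and> 0 < \<eta> \<and> \<eta> \<le> 1 \<and> 0 < \<epsilon> \<and> \<epsilon> \<le> 1 / 2 \<and>
    32 * A * \<epsilon> \<le> \<eta> \<and> (\<forall>\<^sub>F n in sequentially. \<P>(\<omega> in M. \<not> typical A k m \<eta> \<epsilon> n \<omega>) \<le> 7 * e)"
proof -
  have "((\<lambda>A. exp (- ((q * ((A - 2 * c) / 2) powr \<alpha>)\<^sup>2 / 2))) \<longlongrightarrow> 0) at_top"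
    using q_pos \<alpha>_pos by real_asymp
  from order_tendstoD(2)[OF this assms] eventually_gt_at_top[of "2 * c"]
  have "\<forall>\<^sub>F A in at_top. 2 * c < A \<and> exp (- ((q * ((A - 2 * c) / 2) powr \<alpha>)\<^sup>2 / 2)) \<le> e"
    by eventually_elim simp
  then obtain A where A: "2 * c < A" "exp (- ((q * ((A - 2 * c) / 2) powr \<alpha>)\<^sup>2 / 2)) \<le> e"
    by (auto simp: eventually_at_top_linorder)
  have A_pos: "0 < A" using A(1) c_pos by simp
  have "((\<lambda>w. 8 * Q * w powr \<alpha>) \<longlongrightarrow> 0) (at_right 0)"
    using \<alpha>_pos by real_asymp
  from tendsto_0_imp_ex_small[OF this assms u_pos]
  obtain w where w: "0 < w" "w \<le> u" "8 * Q * w powr \<alpha> \<le> e" by blast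
  define m where "m = 4 * A / w"
  have m: "0 < m" "A < w * m / 2" using A_pos w(1) by (auto simp: m_def)
  have "((\<lambda>k. 6 * m * (Q * k powr \<alpha>)\<^sup>2) \<longlongrightarrow> 0) (at_right 0)"
    using \<alpha>_pos Q_pos m(1) by real_asymp
  moreover have "((\<lambda>k. 6 * k * (Q * (8 * A) powr \<alpha>)\<^sup>2) \<longlongrightarrow> 0) (at_right 0)"
    by real_asymp
  ultimately have
    "((\<lambda>k. max (6 * m * (Q * k powr \<alpha>)\<^sup>2) (6 * k * (Q * (8 * A) powr \<alpha>)\<^sup>2)) \<longlongrightarrow> 0) (at_right 0)"
    using tendsto_max by fastforce
  from tendsto_0_imp_ex_small[OF this assms zero_less_one]
  obtain k where k: "0 < k" "k \<le> 1" "6 * m * (Q * k powr \<alpha>)\<^sup>2 \<le> e"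
    "6 * k * (Q * (8 * A) powr \<alpha>)\<^sup>2 \<le> e" by auto
  have "((\<lambda>\<eta>. 36 * (m * Q\<^sup>2)\<^sup>2 * ((8 * A + 1) powr \<alpha>) ^ 3 *
      increment_bound (8 * A + 1) \<eta>) \<longlongrightarrow> 0) (at_right 0)"
    unfolding increment_bound_def using \<alpha>_pos by (intro tendsto_mult_right_zero; real_asymp)
  from tendsto_0_imp_ex_small[OF this assms zero_less_one]
  obtain \<eta> where \<eta>: "0 < \<eta>" "\<eta> \<le> 1"
    "36 * (m * Q\<^sup>2)\<^sup>2 * ((8 * A + 1) powr \<alpha>) ^ 3 * increment_bound (8 * A + 1) \<eta> \<le> e" by blast
  define \<epsilon> where "\<epsilon> = min (1 / 2) (\<eta> / (32 * A))"
  have \<epsilon>: "0 < \<epsilon>" "\<epsilon> \<le> 1 / 2" "32 * A * \<epsilon> \<le> \<eta>"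
    using \<eta>(1) A_pos by (auto simp: \<epsilon>_def min_def field_simps)
  have "\<forall>\<^sub>F n in sequentially. \<P>(\<omega> in M. \<not> typical A k m \<eta> \<epsilon> n \<omega>) \<le> 7 * e"
    by (rule eventually_prob_not_typical) (fact assms A w m k \<eta> \<epsilon>)+
  then show ?thesis using A_pos k(1,2) m(1) \<eta>(1,2) \<epsilon> by blast
qed

lemma eventually_good_parameters:
  assumes "0 < A" "0 \<le> k" "k \<le> 1" "0 < \<eta>" "\<eta> \<le> 1" "\<epsilon> \<le> 1 / 2" "32 * A * \<epsilon> \<le> \<eta>"
  shows "\<forall>\<^sub>F n in sequentially. good_parameters c n (height n) \<epsilon> (slack n) (disc_scale n) A k \<eta>"
proof -
  have "0 < 2 * c" using c_pos by simp
  from eventually_disc_scale_le[OF zero_less_one, of 1]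
    eventually_disc_scale_le[OF this, of "8 * A + 1"]
    eventually_disc_scale_less_height[of "8 * A + 1"] eventually_slack_le eventually_gt_at_top[of 0]
  show ?thesis
    by eventually_elim (use assms disc_scale_pos in \<open>simp add: good_parameters_def\<close>)
qed

abbreviation good :: "real \<Rightarrow> real \<Rightarrow> real \<Rightarrow> real \<Rightarrow> real \<Rightarrow> nat \<Rightarrow> 'a \<Rightarrow> bool" where
  "good A k m \<eta> \<epsilon> n \<omega> \<equiv> good_environment c (signs \<omega>) (potential \<omega>) n (m * range_scale n)
    (height n) \<epsilon> (slack n) (disc_scale n) A k \<eta>"

lemma good_if_typical:
  assumes "good_parameters c n (height n) \<epsilon> (slack n) (disc_scale n) A k \<eta>" "0 \<le> \<epsilon>"
    and "bounded_potential c (signs \<omega>) (potential \<omega>)" "typical A k m \<eta> \<epsilon> n \<omega>"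
  shows "good A k m \<eta> \<epsilon> n \<omega>"
  using assms slack_nonneg
  by (simp add: good_environment_def good_environment_axioms_def regular_environment_def
      regular_environment_axioms_def typical_def mult.assoc disc_scale_mult)

lemma ex_eventually_good:
  assumes "0 < e"
  shows "\<exists>A k m \<eta> \<epsilon>. 0 < A \<and> 0 < k \<and> 0 < m \<and>
    (\<forall>\<^sub>F n in sequentially. \<exists>E\<in>events. 1 - e \<le> prob E \<and> (\<forall>\<omega>\<in>E. good A k m \<eta> \<epsilon> n \<omega>))"
proof -
  have "0 < e / 7" using assms by simp
  from ex_typical_constants[OF this] obtain A k m \<eta> \<epsilon> where
    const: "0 < A" "0 < k" "k \<le> 1" "0 < m" "0 < \<eta>" "\<eta> \<le> 1" "0 < \<epsilon>" "\<epsilon> \<le> 1 / 2" "32 * A * \<epsilon> \<le> \<eta>"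
    and typical: "\<forall>\<^sub>F n in sequentially. \<P>(\<omega> in M. \<not> typical A k m \<eta> \<epsilon> n \<omega>) \<le> 7 * (e / 7)"
    by blast
  have "\<forall>\<^sub>F n in sequentially. good_parameters c n (height n) \<epsilon> (slack n) (disc_scale n) A k \<eta>"
    using const by (intro eventually_good_parameters) auto
  with typical
  have "\<forall>\<^sub>F n in sequentially. \<exists>E\<in>events. 1 - e \<le> prob E \<and> (\<forall>\<omega>\<in>E. good A k m \<eta> \<epsilon> n \<omega>)"
  proof eventually_elim
    case (elim n)
    define E where "E = {\<omega>\<in>space M.
      bounded_potential c (signs \<omega>) (potential \<omega>) \<and> typical A k m \<eta> \<epsilon> n \<omega>}"
    have E: "E \<in> events" unfolding E_def bounded_potential_def by measurable
    have "1 - e \<le> \<P>(\<omega> in M. typical A k m \<eta> \<epsilon> n \<omega>)"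
      using elim(1) prob_neg[of "typical A k m \<eta> \<epsilon> n"] by simp
    also have "\<dots> \<le> prob E"
      using AE_bounded_potential by (intro finite_measure_mono_AE E) (auto simp: E_def)
    finally have "1 - e \<le> prob E" .
    moreover have "good A k m \<eta> \<epsilon> n \<omega>" if "\<omega> \<in> E" for \<omega>
      using that elim(2) const by (intro good_if_typical) (auto simp: E_def)
    ultimately show ?case using E by blast
  qed
  then show ?thesis using const by blast
qed

section \<open>Localization of optimal walks\<close>

definition walk_bounds :: "real \<Rightarrow> real \<Rightarrow> nat \<Rightarrow> (nat \<Rightarrow> int) \<Rightarrow> int \<Rightarrow> 'a \<Rightarrow> bool" where
  "walk_bounds k1 k2 n \<gamma> l \<omega> \<longleftrightarrow>
    (\<forall>i. hit_time \<gamma> l \<le> i \<and> i \<le> n \<longrightarrow> \<gamma> i \<in> {l, l + 1}) \<and>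
    real_of_int \<bar>l\<bar> \<in> {k1 * range_scale n..k2 * range_scale n} \<and>
    edge_disc l \<omega> \<in> {k1 * disc_scale n..k2 * disc_scale n} \<and>
    c * real n + action (signs \<omega>) (potential \<omega>) n \<gamma> \<in> {k1 * range_scale n..k2 * range_scale n}"

lemma walk_bounds_if_good:
  assumes const: "0 < A" "0 < k" "0 < m" and good: "good A k m \<eta> \<epsilon> n \<omega>"
    and opt: "optimal_walk (signs \<omega>) (potential \<omega>) n \<gamma>" "l \<in> \<gamma> ` {0..n}"
      "\<And>x. x \<in> \<gamma> ` {0..n} \<Longrightarrow> edge_disc l \<omega> \<le> edge_disc x \<omega>"
  shows "walk_bounds (k / 8) (k + m + 8 * A) n \<gamma> l \<omega>"
proof -
  interpret optimal_walk_in_good_environment c "signs \<omega>" "potential \<omega>" n "m * range_scale n"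
    "height n" \<epsilon> "slack n" "disc_scale n" A k \<eta> \<gamma> l
    by (intro optimal_walk_in_good_environment.intro optimal_walk_in_good_environment_axioms.intro
        good opt)
  have "0 \<le> range_scale n" "0 \<le> disc_scale n" by (simp_all add: range_scale_def disc_scale_def)
  then have scaled: "x \<le> y \<Longrightarrow> x * range_scale n \<le> y * range_scale n"
    "x \<le> y \<Longrightarrow> x * disc_scale n \<le> y * disc_scale n" for x y
    by (simp_all add: mult_right_mono)
  have const_le: "k / 8 \<le> k" "m \<le> k + m + 8 * A" "8 * A \<le> k + m + 8 * A" "A \<le> k + m + 8 * A"
    using const by auto
  have \<delta>_n: "x * disc_scale n * real n = x * range_scale n" for x
    by (simp add: mult.assoc disc_scale_mult)
  note cost_bounds = total_cost_ge_scale[unfolded sum_step_cost \<delta>_n]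
    total_cost_le[unfolded sum_step_cost \<delta>_n]
  show ?thesis
    unfolding walk_bounds_def atLeastAtMost_iff
  proof (intro conjI allI impI)
    show "\<gamma> i \<in> {l, l + 1}" if "hit_time \<gamma> l \<le> i \<and> i \<le> n" for i
      by (rule stays_on_edge) (use that in auto)
  qed (use abs_l_gt[unfolded \<delta>_n] abs_l_le disc_range_gt[OF l_mem] disc_l_le cost_bounds
      scaled[OF const_le(1)] scaled(1)[OF const_le(2)] scaled(2)[OF const_le(3)]
      scaled(1)[OF const_le(4)] in linarith)+
qed

end

locale optimal_walks = random_environment +
  fixes gam :: "nat \<Rightarrow> 'a \<Rightarrow> nat \<Rightarrow> int" and ell :: "nat \<Rightarrow> 'a \<Rightarrow> int"
  assumes gam_opt: "\<And>n \<omega>. \<omega> \<in> space M \<Longrightarrow> optimal_walk (signs \<omega>) (potential \<omega>) n (gam n \<omega>)"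
    and ell_range: "\<And>n \<omega>. \<omega> \<in> space M \<Longrightarrow> ell n \<omega> \<in> gam n \<omega> ` {0..n}"
    and ell_min: "\<And>n \<omega> x. \<omega> \<in> space M \<Longrightarrow> x \<in> gam n \<omega> ` {0..n} \<Longrightarrow>
      edge_disc (ell n \<omega>) \<omega> \<le> edge_disc x \<omega>"
begin

lemma ex_eventually_walk_bounds:
  assumes "0 < e"
  obtains k1 k2 where "0 < k1" "k1 < k2" "\<forall>\<^sub>F n in sequentially.
    1 - e \<le> lprob M {\<omega>\<in>space M. walk_bounds k1 k2 n (gam n \<omega>) (ell n \<omega>) \<omega>}"
proof -
  obtain A k m \<eta> \<epsilon> where const: "0 < A" "0 < k" "0 < m" and good:
    "\<forall>\<^sub>F n in sequentially. \<exists>E\<in>events. 1 - e \<le> prob E \<and> (\<forall>\<omega>\<in>E. good A k m \<eta> \<epsilon> n \<omega>)"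
    using ex_eventually_good[OF assms] by blast
  from good have "\<forall>\<^sub>F n in sequentially. 1 - e \<le>
    lprob M {\<omega>\<in>space M. walk_bounds (k / 8) (k + m + 8 * A) n (gam n \<omega>) (ell n \<omega>) \<omega>}"
  proof eventually_elim
    case (elim n)
    then obtain E where E: "E \<in> events" "1 - e \<le> prob E" "\<And>\<omega>. \<omega> \<in> E \<Longrightarrow> good A k m \<eta> \<epsilon> n \<omega>"
      by blast
    have "E \<subseteq> {\<omega>\<in>space M. walk_bounds (k / 8) (k + m + 8 * A) n (gam n \<omega>) (ell n \<omega>) \<omega>}"
      using sets.sets_into_space[OF E(1)]
      by (auto intro!: walk_bounds_if_good const E(3) gam_opt ell_range ell_min)
    from prob_le_lprob[OF E(1) this] E(2) show ?case by linarith
  qed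
  then show thesis by (rule that[rotated 2]) (use const in auto)
qed

lemma lprob_stays_on_edge_tendsto_1:
  "(\<lambda>n. lprob M {\<omega>\<in>space M. \<forall>i. hit_time (gam n \<omega>) (ell n \<omega>) \<le> i \<and> i \<le> n \<longrightarrow>
    gam n \<omega> i \<in> {ell n \<omega>, ell n \<omega> + 1}}) \<longlonglongrightarrow> 1"
proof (rule lprob_tendsto_1)
  fix e :: real assume "0 < e"
  then obtain k1 k2 where "\<forall>\<^sub>F n in sequentially.
      1 - e \<le> lprob M {\<omega>\<in>space M. walk_bounds k1 k2 n (gam n \<omega>) (ell n \<omega>) \<omega>}"
    by (rule ex_eventually_walk_bounds)
  then show "\<forall>\<^sub>F n in sequentially. 1 - e \<le> lprob M {\<omega>\<in>space M.
      \<forall>i. hit_time (gam n \<omega>) (ell n \<omega>) \<le> i \<and> i \<le> n \<longrightarrow> gam n \<omega> i \<in> {ell n \<omega>, ell n \<omega> + 1}}"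
    by (elim eventually_mono order_trans; intro lprob_mono; simp add: subset_iff walk_bounds_def)
qed

lemma ex_scale_bounds:
  assumes "0 < e"
  shows "\<exists>k1 k2. 0 < k1 \<and> k1 < k2 \<and> (\<forall>\<^sub>F n in sequentially.
    1 - e \<le> lprob M {\<omega>\<in>space M. k1 * range_scale n \<le> \<bar>ell n \<omega>\<bar> \<and> \<bar>ell n \<omega>\<bar> \<le> k2 * range_scale n} \<and>
    1 - e \<le> lprob M {\<omega>\<in>space M. k1 * disc_scale n \<le> edge_disc (ell n \<omega>) \<omega> \<and>
      edge_disc (ell n \<omega>) \<omega> \<le> k2 * disc_scale n} \<and>
    1 - e \<le> lprob M {\<omega>\<in>space M.
      k1 * range_scale n \<le> c * real n + action (signs \<omega>) (potential \<omega>) n (gam n \<omega>) \<and>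
      c * real n + action (signs \<omega>) (potential \<omega>) n (gam n \<omega>) \<le> k2 * range_scale n})"
proof -
  obtain k1 k2 where k: "0 < k1" "k1 < k2" and bounds: "\<forall>\<^sub>F n in sequentially.
      1 - e \<le> lprob M {\<omega>\<in>space M. walk_bounds k1 k2 n (gam n \<omega>) (ell n \<omega>) \<omega>}"
    using assms by (rule ex_eventually_walk_bounds)
  show ?thesis
    by (intro exI[of _ k1] exI[of _ k2] conjI k eventually_mono[OF bounds]; erule order_trans;
        intro lprob_mono; simp add: subset_iff walk_bounds_def)
qed

end

theorem theorem2p4:
  fixes M :: "'a measure"
    and F :: "int \<Rightarrow> 'a \<Rightarrow> real"
    and B :: "int \<Rightarrow> 'a \<Rightarrow> real"
    and \<rho> :: "real \<Rightarrow> real"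
    and c q \<kappa> :: real
    and gam :: "nat \<Rightarrow> 'a \<Rightarrow> nat \<Rightarrow> int"
    and ell :: "nat \<Rightarrow> 'a \<Rightarrow> int"
  assumes "prob_space M"
    and "c > 0" and "q > 0" and "\<kappa> > -1"
    and indep: "prob_space.indep_vars M (\<lambda>_. borel)
                  (\<lambda>k. case k of Inl x \<Rightarrow> F x | Inr i \<Rightarrow> B i) UNIV"
    and F_dist: "\<And>x. distributed M lborel (F x) (\<lambda>t. ennreal (\<rho> t))"
    and B_rv: "\<And>i. B i \<in> borel_measurable M"
    and B_plus: "\<And>i. prob_space.prob M {\<omega> \<in> space M. B i \<omega> = 1} = 1/2"
    and B_minus: "\<And>i. prob_space.prob M {\<omega> \<in> space M. B i \<omega> = -1} = 1/2"
    and \<rho>_even: "\<And>t. \<rho> (-t) = \<rho> t"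
    and \<rho>_cont: "continuous_on {-c<..<c} \<rho>"
    and \<rho>_pos: "\<And>t. t \<in> {-c<..<c} \<Longrightarrow> \<rho> t > 0"
    and \<rho>_zero: "\<And>t. t \<notin> {-c<..<c} \<Longrightarrow> \<rho> t = 0"
    and \<rho>_edge: "((\<lambda>t. \<rho> t / \<bar>c - t\<bar> powr \<kappa>) \<longlongrightarrow> q) (at_left c)"
    and gam_opt: "\<And>n \<omega>. \<omega> \<in> space M \<Longrightarrow>
                    optimal_walk (\<lambda>i. B i \<omega>) (\<lambda>x. F x \<omega>) n (gam n \<omega>)"
    and ell_range: "\<And>n \<omega>. \<omega> \<in> space M \<Longrightarrow> ell n \<omega> \<in> gam n \<omega> ` {0..n}"
    and ell_min: "\<And>n \<omega> x. \<omega> \<in> space M \<Longrightarrow> x \<in> gam n \<omega> ` {0..n} \<Longrightarrow>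
                    discrepancy c (\<lambda>y. F y \<omega>) (ell n \<omega>) \<le> discrepancy c (\<lambda>y. F y \<omega>) x"
  shows "(\<lambda>n. lprob M {\<omega> \<in> space M. \<forall>i. hit_time (gam n \<omega>) (ell n \<omega>) \<le> i \<and> i \<le> n \<longrightarrow>
                  gam n \<omega> i \<in> {ell n \<omega>, ell n \<omega> + 1}}) \<longlonglongrightarrow> 1
     \<and> (\<forall>\<epsilon>>0. \<exists>k1 k2. 0 < k1 \<and> k1 < k2 \<and>
          (\<forall>\<^sub>F n in sequentially.
             (let \<zeta> = (2 * \<kappa> + 2) / (2 * \<kappa> + 3) in
              lprob M {\<omega> \<in> space M. k1 * real n powr \<zeta> \<le> \<bar>ell n \<omega>\<bar>
                                    \<and> \<bar>ell n \<omega>\<bar> \<le> k2 * real n powr \<zeta>} \<ge> 1 - \<epsilon>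
            \<and> lprob M {\<omega> \<in> space M.
                   k1 * real n powr (\<zeta> - 1) \<le> discrepancy c (\<lambda>y. F y \<omega>) (ell n \<omega>)
                 \<and> discrepancy c (\<lambda>y. F y \<omega>) (ell n \<omega>) \<le> k2 * real n powr (\<zeta> - 1)} \<ge> 1 - \<epsilon>
            \<and> lprob M {\<omega> \<in> space M.
                   k1 * real n powr \<zeta> \<le> c * real n + action (\<lambda>i. B i \<omega>) (\<lambda>x. F x \<omega>) n (gam n \<omega>)
                 \<and> c * real n + action (\<lambda>i. B i \<omega>) (\<lambda>x. F x \<omega>) n (gam n \<omega>) \<le> k2 * real n powr \<zeta>}
                 \<ge> 1 - \<epsilon>)))"
proof -
  obtain lo hi where "0 < lo" "lo < q" "q < hi" using dense[OF \<open>q > 0\<close>] gt_ex by blast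
  moreover from powr_bounds_at_left[OF \<rho>_edge this(2,3)] obtain u where "0 < u"
    "\<And>s. 0 < s \<Longrightarrow> s \<le> u \<Longrightarrow> lo * s powr \<kappa> \<le> \<rho> (c - s) \<and> \<rho> (c - s) \<le> hi * s powr \<kappa>" by blast
  ultimately have "random_environment M F B \<rho> c (\<kappa> + 1) (lo / (\<kappa> + 1)) (hi / (\<kappa> + 1)) u"
    using assms by (intro random_environment.intro random_environment_axioms.intro) simp_all
  then interpret optimal_walks M F B \<rho> c "\<kappa> + 1" "lo / (\<kappa> + 1)" "hi / (\<kappa> + 1)" u gam ell
    using gam_opt ell_range ell_min by (intro optimal_walks.intro optimal_walks_axioms.intro)
  have zeta: "(2 * \<kappa> + 2) / (2 * \<kappa> + 3) = \<zeta>" unfolding \<zeta>_def by (simp add: algebra_simps)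
  show ?thesis
    unfolding Let_def zeta
    using lprob_stays_on_edge_tendsto_1 ex_scale_bounds[unfolded range_scale_def disc_scale_def]
    by (intro conjI allI impI)
qed

end
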